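(* Let $\mathfrak q$ be a finite-dimensional Lie algebra over an algebraically closed field $\Bbbk$ of characteristic $0$ and $\vartheta\in\mathrm{Aut}(\mathfrak q)$ an automorphism of finite order $m$. If $\mathfrak q^*_{\mathsf{reg}}\cap\mathfrak q_0^*\neq\varnothing$, then $\mathcal Z(\widehat{\mathfrak q}^\vartheta,[0])$ is a Poisson-commutative subalgebra of $S(\widehat{\mathfrak q}^\vartheta_+)$.
   Context: Fix a primitive $m$-th root of unity $\zeta$ and let $\mathfrak q_i$ ($0\le i\le m-1$) be the $\zeta^i$-eigenspace of $\vartheta$. For $k\in\mathbb Z$ let $\bar k\in\{0,\dots,m-1\}$ be its residue mod $m$. Extend $\vartheta$ to an automorphism $\Theta$ of the loop algebra $\mathfrak q[t,t^{-1}]=\mathfrak q\otimes\Bbbk[t,t^{-1}]$ by $\Theta(\xi t^k)=\zeta^k\vartheta(\xi)t^k$; the twisted loop algebra is $\widehat{\mathfrak q}^\vartheta=\mathfrak q[t,t^{-1}]^\Theta=\bigoplus_{k\in\mathbb Z}\mathfrak q_{\bar k}t^{-k}$. Put $\widehat{\mathfrak q}^\vartheta_+=\widehat{\mathfrak q}^\vartheta\cap\mathfrak q[t]$ and $\mathfrak q[t^{-1}]^\vartheta=\widehat{\mathfrak q}^\vartheta\cap\mathfrak q[t^{-1}]$. Identifying $\widehat{\mathfrak q}^\vartheta_+$ with the quotient $\widehat{\mathfrak q}^\vartheta/(t^{-1}\mathfrak q[t^{-1}])^\Theta$ gives an action of $\mathfrak q[t^{-1}]^\vartheta$ on $S(\widehat{\mathfrak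 q}^\vartheta_+)$, and $\mathcal Z(\widehat{\mathfrak q}^\vartheta,[0])=S(\widehat{\mathfrak q}^\vartheta_+)^{\mathfrak q[t^{-1}]^\vartheta}$ is the subalgebra of invariants; equivalently, $Y\in S(\widehat{\mathfrak q}^\vartheta_+)$ lies in it iff $\{x,Y\}\in (t^{-1}\mathfrak q[t^{-1}])^\Theta\, S(\widehat{\mathfrak q}^\vartheta)$ for all $x\in\mathfrak q[t^{-1}]^\vartheta$. Here $\{\,,\}$ is the Lie–Poisson bracket on symmetric algebras ($\{x,y\}=[x,y]$ for Lie algebra elements), and Poisson-commutative means $\{Y_1,Y_2\}=0$ for all $Y_1,Y_2$ in the subalgebra. $\mathfrak q_0^*$ is the annihilator of $\bigoplus_{i\ge1}\mathfrak q_i$ in $\mathfrak q^*$; $\mathfrak q^*_{\mathsf{reg}}$ is the set of $\xi\in\mathfrak q^*$ whose stabiliser $\mathfrak q^\xi$ has minimal dimension (equal to $\mathrm{ind}\,\mathfrak q$). *)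

theory Defs
  imports "HOL-Library.Poly_Mapping" "HOL-Library.Function_Algebras" "HOL-Computational_Algebra.Polynomial"
begin

text \<open>The Lie algebra q has dimension n and is identified with k^n via a basis
e_0,...,e_{n-1}; vectors of q are functions nat => k vanishing outside {..<n}.
The bracket is given by structure constants: [e_i,e_j] = sum_l c i j l e_l.
The automorphism theta is given by its matrix: theta e_j = sum_i th i j e_i.
Linear forms on q are functions nat => k (only the first n entries matter):
xi(x) = sum_{l<n} xi l * x l.\<close>

definition alg_closed :: "'k::field itself \<Rightarrow> bool" where
  "alg_closed _ \<longleftrightarrow> (\<forall>p :: 'k poly. degree p \<ge> 1 \<longrightarrow> (\<exists>x. poly p x = 0))"

definition qvec :: "nat \<Rightarrow> (nat \<Rightarrow> 'k::field) set" where
  "qvec n = {x. \<forall>i\<ge>n. x i = 0}"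

definition qbr :: "nat \<Rightarrow> (nat \<Rightarrow> nat \<Rightarrow> nat \<Rightarrow> 'k::field)
    \<Rightarrow> (nat \<Rightarrow> 'k) \<Rightarrow> (nat \<Rightarrow> 'k) \<Rightarrow> (nat \<Rightarrow> 'k)" where
  "qbr n c x y = (\<lambda>l. if l < n then (\<Sum>i<n. \<Sum>j<n. x i * y j * c i j l) else 0)"

definition vscale :: "'k::field \<Rightarrow> (nat \<Rightarrow> 'k) \<Rightarrow> (nat \<Rightarrow> 'k)" where
  "vscale a x = (\<lambda>i. a * x i)"

definition is_lie_algebra :: "nat \<Rightarrow> (nat \<Rightarrow> nat \<Rightarrow> nat \<Rightarrow> 'k::field) \<Rightarrow> bool" where
  "is_lie_algebra n c \<longleftrightarrow>
     (\<forall>x\<in>qvec n. qbr n c x x = (\<lambda>_. 0)) \<and>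
     (\<forall>x\<in>qvec n. \<forall>y\<in>qvec n. \<forall>z\<in>qvec n.
        (\<lambda>l. qbr n c x (qbr n c y z) l + qbr n c y (qbr n c z x) l + qbr n c z (qbr n c x y) l)
        = (\<lambda>_. 0))"

definition matapp :: "nat \<Rightarrow> (nat \<Rightarrow> nat \<Rightarrow> 'k::field) \<Rightarrow> (nat \<Rightarrow> 'k) \<Rightarrow> (nat \<Rightarrow> 'k)" where
  "matapp n th x = (\<lambda>i. if i < n then (\<Sum>j<n. th i j * x j) else 0)"

definition is_aut_order :: "nat \<Rightarrow> (nat \<Rightarrow> nat \<Rightarrow> nat \<Rightarrow> 'k::field)
    \<Rightarrow> (nat \<Rightarrow> nat \<Rightarrow> 'k) \<Rightarrow> nat \<Rightarrow> bool" where
  "is_aut_order n c th m \<longleftrightarrow>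
     bij_betw (matapp n th) (qvec n) (qvec n) \<and>
     (\<forall>x\<in>qvec n. \<forall>y\<in>qvec n. matapp n th (qbr n c x y) = qbr n c (matapp n th x) (matapp n th y)) \<and>
     0 < m \<and>
     (\<forall>x\<in>qvec n. (matapp n th ^^ m) x = x) \<and>
     (\<forall>k. 0 < k \<and> k < m \<longrightarrow> (\<exists>x\<in>qvec n. (matapp n th ^^ k) x \<noteq> x))"

definition primitive_root :: "nat \<Rightarrow> 'k::field \<Rightarrow> bool" where
  "primitive_root m z \<longleftrightarrow> z ^ m = 1 \<and> (\<forall>k. 0 < k \<and> k < m \<longrightarrow> z ^ k \<noteq> 1)"

definition eigsp :: "nat \<Rightarrow> (nat \<Rightarrow> nat \<Rightarrow> 'k::field) \<Rightarrow> 'k \<Rightarrow> nat \<Rightarrow> (nat \<Rightarrow> 'k) set" where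
  "eigsp n th z i = {x \<in> qvec n. matapp n th x = vscale (z ^ i) x}"

definition pairing :: "nat \<Rightarrow> (nat \<Rightarrow> 'k::field) \<Rightarrow> (nat \<Rightarrow> 'k) \<Rightarrow> 'k" where
  "pairing n xi x = (\<Sum>l<n. xi l * x l)"

definition dual0 :: "nat \<Rightarrow> (nat \<Rightarrow> nat \<Rightarrow> 'k::field) \<Rightarrow> 'k \<Rightarrow> nat \<Rightarrow> (nat \<Rightarrow> 'k) set" where
  "dual0 n th z m = {xi. \<forall>i. 1 \<le> i \<and> i < m \<longrightarrow> (\<forall>x\<in>eigsp n th z i. pairing n xi x = 0)}"

definition stab :: "nat \<Rightarrow> (nat \<Rightarrow> nat \<Rightarrow> nat \<Rightarrow> 'k::field) \<Rightarrow> (nat \<Rightarrow> 'k) \<Rightarrow> (nat \<Rightarrow> 'k) set" where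
  "stab n c xi = {x \<in> qvec n. \<forall>y\<in>qvec n. pairing n xi (qbr n c x y) = 0}"

definition vdim :: "(nat \<Rightarrow> 'k::field) set \<Rightarrow> nat" where
  "vdim S = vector_space.dim (vscale :: 'k \<Rightarrow> _) S"

definition regular :: "nat \<Rightarrow> (nat \<Rightarrow> nat \<Rightarrow> nat \<Rightarrow> 'k::field) \<Rightarrow> (nat \<Rightarrow> 'k) set" where
  "regular n c = {xi. \<forall>eta. vdim (stab n c xi) \<le> vdim (stab n c eta)}"

text \<open>An element of q[t,t^{-1}] is a finitely supported map (i,a) |-> coefficient of e_i t^a,
with i < n. S(q[t,t^{-1}]) is the polynomial ring in the variables e_i t^a.\<close>

type_synonym 'k loopel = "(nat \<times> int) \<Rightarrow>\<^sub>0 'k"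
type_synonym 'k spoly = "((nat \<times> int) \<Rightarrow>\<^sub>0 nat) \<Rightarrow>\<^sub>0 'k"

definition loopvec :: "nat \<Rightarrow> 'k::field loopel set" where
  "loopvec n = {x. \<forall>(i,a)\<in>Poly_Mapping.keys x. i < n}"

definition tcoef :: "'k::field loopel \<Rightarrow> int \<Rightarrow> (nat \<Rightarrow> 'k)" where
  "tcoef x a = (\<lambda>i. Poly_Mapping.lookup x (i, a))"

text \<open>x is Theta-invariant: zeta^a theta(x_a) = x_a for all a.\<close>
definition twisted :: "nat \<Rightarrow> (nat \<Rightarrow> nat \<Rightarrow> 'k::field) \<Rightarrow> 'k \<Rightarrow> 'k loopel set" where
  "twisted n th z = {x \<in> loopvec n. \<forall>a. vscale (z powi a) (matapp n th (tcoef x a)) = tcoef x a}"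

definition twisted_plus :: "nat \<Rightarrow> (nat \<Rightarrow> nat \<Rightarrow> 'k::field) \<Rightarrow> 'k \<Rightarrow> 'k loopel set" where
  "twisted_plus n th z = {x \<in> twisted n th z. \<forall>(i,a)\<in>Poly_Mapping.keys x. 0 \<le> a}"

definition twisted_nonpos :: "nat \<Rightarrow> (nat \<Rightarrow> nat \<Rightarrow> 'k::field) \<Rightarrow> 'k \<Rightarrow> 'k loopel set" where
  "twisted_nonpos n th z = {x \<in> twisted n th z. \<forall>(i,a)\<in>Poly_Mapping.keys x. a \<le> 0}"

definition twisted_neg :: "nat \<Rightarrow> (nat \<Rightarrow> nat \<Rightarrow> 'k::field) \<Rightarrow> 'k \<Rightarrow> 'k loopel set" where
  "twisted_neg n th z = {x \<in> twisted n th z. \<forall>(i,a)\<in>Poly_Mapping.keys x. a < 0}"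

definition var :: "nat \<times> int \<Rightarrow> 'k::field spoly" where
  "var v = Poly_Mapping.single (Poly_Mapping.single v 1) 1"

definition const :: "'k::field \<Rightarrow> 'k spoly" where
  "const a = Poly_Mapping.single 0 a"

definition linp :: "'k::field loopel \<Rightarrow> 'k spoly" where
  "linp x = (\<Sum>v\<in>Poly_Mapping.keys x. const (Poly_Mapping.lookup x v) * var v)"

text \<open>S(U) for a subspace U, realised as the subalgebra of S(q[t,t^{-1}]) generated by U.\<close>
inductive_set salg :: "'k::field loopel set \<Rightarrow> 'k spoly set" for U where
  const: "const a \<in> salg U"
| lin: "x \<in> U \<Longrightarrow> linp x \<in> salg U"
| add: "f \<in> salg U \<Longrightarrow> g \<in> salg U \<Longrightarrow> f + g \<in> salg U"
| mult: "f \<in> salg U \<Longrightarrow> g \<in> salg U \<Longrightarrow> f * g \<in> salg U"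

inductive_set idealgen :: "'k::field loopel set \<Rightarrow> 'k spoly set \<Rightarrow> 'k spoly set" for U R where
  zero: "0 \<in> idealgen U R"
| gen: "x \<in> U \<Longrightarrow> f \<in> R \<Longrightarrow> linp x * f \<in> idealgen U R"
| add: "f \<in> idealgen U R \<Longrightarrow> g \<in> idealgen U R \<Longrightarrow> f + g \<in> idealgen U R"

definition loopbr_basis :: "nat \<Rightarrow> (nat \<Rightarrow> nat \<Rightarrow> nat \<Rightarrow> 'k::field)
    \<Rightarrow> nat \<times> int \<Rightarrow> nat \<times> int \<Rightarrow> 'k spoly" where
  "loopbr_basis n c u v = (\<Sum>l<n. const (c (fst u) (fst v) l) * var (l, snd u + snd v))"

definition pvars :: "'k::field spoly \<Rightarrow> (nat \<times> int) set" where
  "pvars f = (\<Union>mon\<in>Poly_Mapping.keys f. Poly_Mapping.keys mon)"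

definition pdiff :: "nat \<times> int \<Rightarrow> 'k::field spoly \<Rightarrow> 'k spoly" where
  "pdiff v f = (\<Sum>mon\<in>Poly_Mapping.keys f.
      Poly_Mapping.single (mon - Poly_Mapping.single v 1) (of_nat (Poly_Mapping.lookup mon v) * Poly_Mapping.lookup f mon))"

text \<open>Lie-Poisson bracket on S(q[t,t^{-1}]): the biderivation extending the Lie bracket.\<close>
definition pbr :: "nat \<Rightarrow> (nat \<Rightarrow> nat \<Rightarrow> nat \<Rightarrow> 'k::field) \<Rightarrow> 'k spoly \<Rightarrow> 'k spoly \<Rightarrow> 'k spoly" where
  "pbr n c f g = (\<Sum>u\<in>pvars f. \<Sum>v\<in>pvars g. pdiff u f * pdiff v g * loopbr_basis n c u v)"

text \<open>Z(q^theta, [0]) = S(q^theta_+)^{q[t^{-1}]^theta}.\<close>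
definition Zcent :: "nat \<Rightarrow> (nat \<Rightarrow> nat \<Rightarrow> nat \<Rightarrow> 'k::field) \<Rightarrow> (nat \<Rightarrow> nat \<Rightarrow> 'k) \<Rightarrow> 'k \<Rightarrow> 'k spoly set" where
  "Zcent n c th z = {Y \<in> salg (twisted_plus n th z).
      \<forall>x\<in>twisted_nonpos n th z.
        pbr n c (linp x) Y \<in> idealgen (twisted_neg n th z) (salg (twisted n th z))}"

end

theory Submission
  imports Defs "Jordan_Normal_Form.Determinant"
begin

text \<open>A point \<open>\<xi>\<close> of the dual of the twisted loop algebra that kills negative powers of \<open>t\<close> is a
polynomial \<open>\<xi>(w) = \<Sum> \<xi>\<^sub>a w\<^sup>a\<close> in \<open>w = t\<^sup>-\<^sup>1\<close>, and \<open>x, y \<mapsto> \<xi>(w)([x, y])\<close> is a skew polynomial matrix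
\<open>A(w)\<close>. If \<open>Y\<close> is invariant with differential \<open>\<Sum> y\<^sub>a t\<^sup>a\<close> at \<open>\<xi>\<close> and \<open>p(w) = \<Sum> y\<^sub>a w\<^sup>N\<^sup>-\<^sup>a\<close>, then
\<open>A p\<close> is divisible by \<open>w\<^sup>N\<^sup>+\<^sup>1\<close>, whereas \<open>{Y\<^sub>1, Y\<^sub>2}(\<xi>)\<close> is the coefficient of \<open>w\<^sup>2\<^sup>N\<close> in \<open>p\<^sub>1\<^sup>T A p\<^sub>2\<close>.

Regularity provides a polynomial pseudo-inverse of \<open>A\<close>. Given \<open>\<rho>\<close> regular, choose a set \<open>J\<close> of coordinates
onto which the stabiliser of \<open>\<rho>\<close> projects isomorphically, and let \<open>B\<close> and \<open>d\<close> be the adjugate and the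
determinant of \<open>A + 1\<^sub>J\<close>. Since no stabiliser is smaller than that of \<open>\<rho>\<close>, one has \<open>A B A = d A\<close>, so
\<open>d p\<^sub>1\<^sup>T A p\<^sub>2 = - (A p\<^sub>1)\<^sup>T B (A p\<^sub>2)\<close> is divisible by \<open>w\<^sup>2\<^sup>N\<^sup>+\<^sup>2\<close>, and \<open>{Y\<^sub>1, Y\<^sub>2}(\<xi>) = 0\<close> as soon as \<open>d(0)\<close> is
nonzero. This holds at all but finitely many points of the line joining any invariant point to \<open>\<rho>\<close>.\<close>

section \<open>Skew polynomial matrices\<close>

definition dotp :: "nat \<Rightarrow> (nat \<Rightarrow> 'a::comm_ring_1) \<Rightarrow> (nat \<Rightarrow> 'a) \<Rightarrow> 'a" where
  "dotp n x y = (\<Sum>i<n. x i * y i)"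

definition mvec :: "nat \<Rightarrow> (nat \<Rightarrow> nat \<Rightarrow> 'a::comm_ring_1) \<Rightarrow> (nat \<Rightarrow> 'a) \<Rightarrow> nat \<Rightarrow> 'a" where
  "mvec n A x i = (\<Sum>j<n. A i j * x j)"

definition inj_mat :: "nat \<Rightarrow> (nat \<Rightarrow> nat \<Rightarrow> 'a::comm_ring_1) \<Rightarrow> bool" where
  "inj_mat n A \<longleftrightarrow> (\<forall>x. (\<forall>i<n. mvec n A x i = 0) \<longrightarrow> (\<forall>i<n. x i = 0))"

definition poly_mat :: "(nat \<Rightarrow> nat \<Rightarrow> 'a::comm_ring_1 poly) \<Rightarrow> 'a \<Rightarrow> nat \<Rightarrow> nat \<Rightarrow> 'a" where
  "poly_mat A w i j = poly (A i j) w"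

lemma mvec_cong: "(\<And>j. j < n \<Longrightarrow> x j = y j) \<Longrightarrow> mvec n A x i = mvec n A y i"
  by (simp add: mvec_def)

lemma mvec_scale: "mvec n A (\<lambda>j. a * x j) i = a * mvec n A x i"
  by (simp add: mvec_def sum_distrib_left mult_ac)

lemma mvec_diff: "mvec n A (\<lambda>j. x j - y j) i = mvec n A x i - mvec n A y i"
  by (simp add: mvec_def sum_subtractf algebra_simps)

lemma poly_mvec: "poly (mvec n A x i) w = mvec n (poly_mat A w) (\<lambda>j. poly (x j) w) i"
  by (simp add: mvec_def poly_sum poly_mat_def)

lemma dotp_mvec_skew:
  assumes "\<And>i j. i < n \<Longrightarrow> j < n \<Longrightarrow> A i j = - A j i"
  shows "dotp n x (mvec n A y) = - dotp n (mvec n A x) y"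
proof -
  have "dotp n x (mvec n A y) = (\<Sum>i<n. \<Sum>j<n. x i * (A i j * y j))"
    by (simp add: dotp_def mvec_def sum_distrib_left)
  also have "\<dots> = (\<Sum>j<n. \<Sum>i<n. x i * (A i j * y j))"
    by (rule sum.swap)
  also have "\<dots> = (\<Sum>j<n. \<Sum>i<n. - (A j i * x i * y j))"
  proof (intro sum.cong refl, goal_cases)
    case (1 j i)
    then show ?case using assms[of i j] by (simp add: mult_ac)
  qed
  also have "\<dots> = - dotp n (mvec n A x) y"
    by (simp add: dotp_def mvec_def sum_distrib_right sum_negf)
  finally show ?thesis .
qed

text \<open>The product \<open>d * (p - q)\<close> vanishes at every point, which over an infinite
  field forces it to be zero. Identities thus only need checking where a nonzero determinant
  \<open>d\<close> does not vanish.\<close>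

lemma poly_eqI_cofinite:
  fixes p q d :: "'k::field_char_0 poly"
  assumes "d \<noteq> 0" "\<And>w. poly d w \<noteq> 0 \<Longrightarrow> poly p w = poly q w"
  shows "p = q"
proof -
  have "poly (d * (p - q)) w = 0" for w
    using assms(2)[of w] by (cases "poly d w = 0") auto
  then have "d * (p - q) = 0" using poly_all_0_iff_0 by blast
  then show ?thesis using assms(1) by simp
qed

text \<open>Take for \<open>B\<close> and \<open>d\<close> the adjugate and the determinant of
  \<open>M\<close>. A zero of \<open>d\<close> at \<open>w0\<close> would give \<open>M(w0)\<close>
  a nonzero kernel vector; conversely \<open>B(w) M(w) = d(w)\<close> makes \<open>M(w)\<close>
  injective wherever \<open>d(w)\<close> is nonzero.\<close>

lemma adjugate_exists:
  fixes M :: "nat \<Rightarrow> nat \<Rightarrow> 'k::field poly"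
  assumes "inj_mat n (poly_mat M w0)"
  shows "\<exists>B d. poly d w0 \<noteq> 0 \<and> (\<forall>x. \<forall>i<n. mvec n B (mvec n M x) i = d * x i) \<and>
    (\<forall>w. poly d w \<noteq> 0 \<longrightarrow> inj_mat n (poly_mat M w))"
proof -
  define A where "A = mat n n (\<lambda>(i,j). M i j)"
  have A: "A \<in> carrier_mat n n" by (simp add: A_def)
  define B where "B = (\<lambda>i j. adj_mat A $$ (i,j))"
  have BA: "(\<Sum>j<n. B i j * M j k) = (if i = k then det A else 0)" if "i < n" "k < n" for i k
  proof -
    have "(adj_mat A * A) $$ (i,k) = (\<Sum>j<n. B i j * M j k)"
      using that A adj_mat(1)[OF A] 
      by (auto simp: times_mat_def scalar_prod_def B_def A_def atLeast0LessThan intro!: sum.cong)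
    moreover have "(adj_mat A * A) $$ (i,k) = (if i = k then det A else 0)"
      using that by (simp add: adj_mat(3)[OF A])
    ultimately show ?thesis by simp
  qed
  have BM: "mvec n B (mvec n M x) i = det A * x i" if "i < n" for x i
  proof -
    have "mvec n B (mvec n M x) i = (\<Sum>j<n. \<Sum>k<n. B i j * M j k * x k)"
      by (simp add: mvec_def sum_distrib_left mult_ac)
    also have "\<dots> = (\<Sum>k<n. (\<Sum>j<n. B i j * M j k) * x k)"
      by (subst sum.swap) (simp add: sum_distrib_right)
    also have "\<dots> = (\<Sum>k<n. if i = k then det A * x k else 0)"
      using that by (intro sum.cong) (auto simp: BA)
    finally show ?thesis using that by simp
  qed
  have "poly (det A) w0 \<noteq> 0"
  proof
    \<comment> \<open>Evaluation at \<open>w0\<close> is a ring homomorphism, so it commutes with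
      the determinant.\<close>
    interpret h: comm_ring_hom "\<lambda>p::'k poly. poly p w0"
      by unfold_locales auto
    let ?A = "map_mat (\<lambda>p. poly p w0) A"
    assume "poly (det A) w0 = 0"
    then have "det ?A = 0" by simp
    moreover have cA: "?A \<in> carrier_mat n n" using A by simp
    ultimately obtain v where v: "v \<in> carrier_vec n" "v \<noteq> 0\<^sub>v n" "?A *\<^sub>v v = 0\<^sub>v n"
      using det_0_iff_vec_prod_zero_field[OF cA] by blast
    have "mvec n (poly_mat M w0) (\<lambda>j. v $ j) i = 0" if "i < n" for i
    proof -
      have "(?A *\<^sub>v v) $ i = mvec n (poly_mat M w0) (\<lambda>j. v $ j) i"
        using that v(1) A
        by (auto simp: mult_mat_vec_def scalar_prod_def mvec_def poly_mat_def A_def atLeast0LessThan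
            intro!: sum.cong)
      then show ?thesis using v(3) that by simp
    qed
    then have "\<forall>i<n. v $ i = 0" using assms unfolding inj_mat_def by blast
    then have "v = 0\<^sub>v n" using v(1) by (intro eq_vecI) auto
    then show False using v(2) by simp
  qed
  moreover have "inj_mat n (poly_mat M w)" if w: "poly (det A) w \<noteq> 0" for w
    unfolding inj_mat_def
  proof (intro allI impI)
    fix y i assume y: "\<forall>i<n. mvec n (poly_mat M w) y i = 0" and i: "i < n"
    \<comment> \<open>The scalar vector \<open>y\<close> is lifted to constant polynomials so that
      \<open>BM\<close> can be evaluated at \<open>w\<close>.\<close>
    have "poly (det A) w * y i = mvec n (poly_mat B w) (mvec n (poly_mat M w) y) i"
      using arg_cong[OF BM[OF i, of "\<lambda>i. [:y i:]"], of "\<lambda>p. poly p w"] by (simp add: poly_mvec)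
    also have "\<dots> = mvec n (poly_mat B w) (\<lambda>_. 0) i"
      by (rule mvec_cong) (use y in auto)
    finally show "y i = 0" using w by (simp add: mvec_def)
  qed
  ultimately show ?thesis using BM by blast
qed

definition add_diag :: "nat set \<Rightarrow> (nat \<Rightarrow> nat \<Rightarrow> 'a::comm_ring_1) \<Rightarrow> nat \<Rightarrow> nat \<Rightarrow> 'a" where
  "add_diag J A i j = A i j + (if i = j \<and> i \<in> J then 1 else 0)"

lemma mvec_add_diag:
  "i < n \<Longrightarrow> mvec n (add_diag J A) x i = mvec n A x i + (if i \<in> J then x i else 0)"
proof -
  assume "i < n"
  have "(\<Sum>j<n. (if i = j \<and> i \<in> J then 1 else 0) * x j) = (\<Sum>j<n. if i = j then (if i \<in> J then x j else 0) else 0)"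
    by (intro sum.cong) auto
  then show ?thesis using \<open>i < n\<close>
    by (simp add: mvec_def add_diag_def sum.distrib distrib_right)
qed

lemma poly_mat_add_diag: "poly_mat (add_diag J A) w = add_diag J (poly_mat A w)"
  by (auto simp: poly_mat_def add_diag_def fun_eq_iff)

text \<open>\<open>d\<close> has order 0 at 0, so the whole order of vanishing of
  \<open>d * p\<close> there comes from \<open>p\<close>.\<close>

lemma monom_dvd_cancel:
  fixes d p :: "'k::field poly"
  assumes "monom 1 e dvd d * p" "poly d 0 \<noteq> 0"
  shows "monom 1 e dvd p"
proof (cases "p = 0")
  case False
  have d: "d \<noteq> 0" "order 0 d = 0" using assms(2) by (auto simp: order_root)
  with False have "e \<le> order 0 (d * p)" using assms(1) by (subst monom_1_dvd_iff[symmetric]) auto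
  with False d show ?thesis by (simp add: monom_1_dvd_iff order_mult)
qed auto

text \<open>With \<open>B\<close> and \<open>d\<close> the adjugate and determinant of
  \<open>A + 1_J\<close>, the key identity is \<open>A B A = d A\<close>. Skewness then turns
  \<open>d p^T A q = p^T A B A q\<close> into \<open>- (A p)^T B (A q)\<close>, where each outer
  factor contributes \<open>w^e\<close>. The hypothesis \<open>ker\<close> says that the kernel of
  \<open>A(w)\<close> projects onto the coordinates in \<open>J\<close> whenever
  \<open>A(w) + 1_J\<close> is injective.\<close>

lemma skew_form_high_order:
  fixes A :: "nat \<Rightarrow> nat \<Rightarrow> 'k::field_char_0 poly"
  assumes skew: "\<And>i j. i < n \<Longrightarrow> j < n \<Longrightarrow> A i j = - A j i"
    and inj0: "inj_mat n (add_diag J (poly_mat A 0))"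
    and ker: "\<And>w x. inj_mat n (add_diag J (poly_mat A w)) \<Longrightarrow>
      \<exists>v. (\<forall>i<n. mvec n (poly_mat A w) v i = 0) \<and> (\<forall>j<n. j \<in> J \<longrightarrow> v j = x j)"
    and p: "\<And>i. i < n \<Longrightarrow> monom 1 e dvd mvec n A p i"
    and q: "\<And>i. i < n \<Longrightarrow> monom 1 e dvd mvec n A q i"
  shows "monom 1 (2 * e) dvd dotp n p (mvec n A q)"
proof -
  have "inj_mat n (poly_mat (add_diag J A) 0)" using inj0 by (simp add: poly_mat_add_diag)
  then obtain B d where d0: "poly d 0 \<noteq> 0"
    and BM: "\<And>x i. i < n \<Longrightarrow> mvec n B (mvec n (add_diag J A) x) i = d * x i"
    and inj: "\<And>w. poly d w \<noteq> 0 \<Longrightarrow> inj_mat n (add_diag J (poly_mat A w))"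
    using adjugate_exists[of n "add_diag J A" 0] unfolding poly_mat_add_diag by blast
  have dn: "d \<noteq> 0" using d0 by auto
  have ABA: "mvec n A (mvec n B (mvec n A x)) i = d * mvec n A x i" if "i < n" for x i
  proof (rule poly_eqI_cofinite[OF dn])
    fix w assume w: "poly d w \<noteq> 0"
    let ?A = "poly_mat A w" and ?B = "poly_mat B w" and ?d = "poly d w"
    have BMw: "mvec n ?B (mvec n (add_diag J ?A) y) i = ?d * y i" if "i < n" for y i
      using arg_cong[OF BM[OF that, of "\<lambda>i. [:y i:]"], of "\<lambda>p. poly p w"]
      by (simp add: poly_mvec poly_mat_add_diag)
    define y where "y = (\<lambda>j. poly (x j) w)"
    obtain v where v0: "\<forall>i<n. mvec n ?A v i = 0" and vJ: "\<forall>j<n. j \<in> J \<longrightarrow> v j = y j"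
      using ker[OF inj[OF w], of y] by blast
    \<comment> \<open>Subtracting a kernel vector that agrees with \<open>y\<close> on
      \<open>J\<close> leaves a \<open>u\<close> that is zero on \<open>J\<close> and has the same
      image under \<open>A(w)\<close>. Hence \<open>(A + 1_J) u = A y\<close>, and applying
      \<open>B\<close> gives \<open>B A y = d u\<close>.\<close>
    define u where "u = (\<lambda>j. y j - v j)"
    have Au: "mvec n ?A u i = mvec n ?A y i" if "i < n" for i
      using v0 that by (simp add: u_def mvec_diff)
    have Mu: "mvec n (add_diag J ?A) u i = mvec n ?A y i" if "i < n" for i
      using that vJ by (auto simp: mvec_add_diag Au) (simp add: u_def)
    have "mvec n ?A (mvec n ?B (mvec n ?A y)) i = mvec n ?A (\<lambda>j. ?d * u j) i"
    proof (rule mvec_cong)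
      fix j assume j: "j < n"
      have "mvec n ?B (mvec n ?A y) j = mvec n ?B (mvec n (add_diag J ?A) u) j"
        by (rule mvec_cong) (simp add: Mu)
      then show "mvec n ?B (mvec n ?A y) j = ?d * u j" by (simp add: BMw j)
    qed
    also have "\<dots> = ?d * mvec n ?A y i" using that by (simp add: mvec_scale Au)
    finally show "poly (mvec n A (mvec n B (mvec n A x)) i) w = poly (d * mvec n A x i) w"
      by (simp add: poly_mvec y_def)
  qed
  have "d * dotp n p (mvec n A q) = dotp n p (mvec n A (mvec n B (mvec n A q)))"
    by (simp add: dotp_def ABA sum_distrib_left mult_ac)
  also have "\<dots> = - dotp n (mvec n A p) (mvec n B (mvec n A q))"
    by (rule dotp_mvec_skew[OF skew])
  also have "monom 1 (2 * e) dvd \<dots>"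
  proof -
    have sq: "monom (1::'k) (2 * e) = monom 1 e * monom 1 e" by (simp add: mult_monom mult_2)
    have "monom 1 e dvd mvec n B (mvec n A q) i" for i
      unfolding mvec_def[of n B] by (intro dvd_sum dvd_mult q) auto
    then show ?thesis
      unfolding sq dvd_minus_iff dotp_def by (intro dvd_sum mult_dvd_mono p) auto
  qed
  finally show ?thesis by (rule monom_dvd_cancel[OF _ d0])
qed

section \<open>Pivots of the stabiliser of a regular form\<close>

global_interpretation qv: vector_space "vscale :: 'k::field \<Rightarrow> (nat \<Rightarrow> 'k) \<Rightarrow> _"
  by unfold_locales (auto simp: vscale_def fun_eq_iff algebra_simps)

definition unitv :: "nat \<Rightarrow> nat \<Rightarrow> 'a::comm_ring_1" where
  "unitv j i = (if i = j then 1 else 0)"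

lemma unitv_qvec: "j < n \<Longrightarrow> unitv j \<in> qvec n"
  by (auto simp: unitv_def qvec_def)

lemma supported_in_span_unitv:
  fixes x :: "nat \<Rightarrow> 'k::field"
  assumes "finite J" "\<And>i. i \<notin> J \<Longrightarrow> x i = 0"
  shows "x \<in> qv.span (unitv ` J)"
proof -
  have "x = (\<Sum>j\<in>J. vscale (x j) (unitv j))"
  proof
    fix i
    have sum_ap: "(\<Sum>j\<in>J. f j) i = (\<Sum>j\<in>J. f j i)" for f :: "nat \<Rightarrow> nat \<Rightarrow> 'k"
      by (induction J rule: infinite_finite_induct) auto
    have "(\<Sum>j\<in>J. vscale (x j) (unitv j)) i = (\<Sum>j\<in>J. if i = j then x j else 0)"
      unfolding sum_ap by (intro sum.cong) (auto simp: vscale_def unitv_def)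
    then show "x i = (\<Sum>j\<in>J. vscale (x j) (unitv j)) i" using assms by auto
  qed
  also have "\<dots> \<in> qv.span (unitv ` J)"
    by (intro qv.span_sum qv.span_scale qv.span_base) auto
  finally show ?thesis .
qed

lemma independent_unitv: "qv.independent (unitv ` J :: (nat \<Rightarrow> 'k::field) set)"
  unfolding qv.dependent_def
proof clarify
  fix j assume j: "j \<in> J" "(unitv j :: nat \<Rightarrow> 'k) \<in> qv.span (unitv ` J - {unitv j})"
  have "qv.subspace {x :: nat \<Rightarrow> 'k. x j = 0}"
    by (auto simp: qv.subspace_def vscale_def)
  moreover have "unitv ` J - {unitv j} \<subseteq> {x :: nat \<Rightarrow> 'k. x j = 0}"
    by (auto simp: unitv_def)
  ultimately have "(unitv j :: nat \<Rightarrow> 'k) \<in> {x. x j = 0}"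
    using qv.span_minimal j(2) by blast
  then show False by (simp add: unitv_def)
qed

lemma inj_unitv: "inj (unitv :: nat \<Rightarrow> nat \<Rightarrow> 'k::field)"
proof (rule injI)
  fix i j assume "unitv i = (unitv j :: nat \<Rightarrow> 'k)"
  from fun_cong[OF this, of i] show "i = j" by (simp add: unitv_def split: if_splits)
qed

lemma subspace_basis_qvec:
  fixes V :: "(nat \<Rightarrow> 'k::field) set"
  assumes "V \<subseteq> qvec n"
  obtains B where "B \<subseteq> V" "qv.independent B" "V \<subseteq> qv.span B" "card B = vdim V" "finite B"
proof -
  obtain B where B: "B \<subseteq> V" "qv.independent B" "V \<subseteq> qv.span B" "card B = vdim V"
    using qv.basis_exists[of V] unfolding vdim_def by blast
  have "B \<subseteq> qv.span (unitv ` {..<n})"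
    using B(1) assms by (intro subsetI supported_in_span_unitv) (auto simp: qvec_def)
  then have "finite B" using qv.independent_span_bound[OF _ B(2)] by blast
  then show ?thesis using that B by blast
qed

text \<open>Choose \<open>J\<close> of least cardinality among the coordinate sets on which no
  nonzero vector of \<open>V\<close> vanishes. By minimality, removing \<open>j\<close> admits a
  nonzero vector of \<open>V\<close> that vanishes on the rest of \<open>J\<close>; it is nonzero at
  \<open>j\<close>, and rescaling it gives the vector dual to \<open>j\<close>.\<close>

lemma pivots_exist:
  fixes V :: "(nat \<Rightarrow> 'k::field) set"
  assumes V: "V \<subseteq> qvec n" "qv.subspace V"
  obtains J where "J \<subseteq> {..<n}" "\<And>x. x \<in> V \<Longrightarrow> (\<forall>j\<in>J. x j = 0) \<Longrightarrow> x = 0"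
    "\<And>j. j \<in> J \<Longrightarrow> \<exists>v\<in>V. \<forall>i\<in>J. v i = unitv j i"
proof -
  define P where "P J \<longleftrightarrow> J \<subseteq> {..<n} \<and> (\<forall>x\<in>V. (\<forall>j\<in>J. x j = 0) \<longrightarrow> x = 0)" for J
  have "x = 0" if "x \<in> V" "\<forall>j\<in>{..<n}. x j = 0" for x
  proof
    fix i
    have "x i = 0" if "n \<le> i" using \<open>x \<in> V\<close> V(1) that unfolding qvec_def by blast
    then show "x i = 0 i" using \<open>\<forall>j\<in>{..<n}. x j = 0\<close> by (cases "i < n") auto
  qed
  then have "P {..<n}" unfolding P_def by blast
  then obtain J where J: "P J" and min: "\<And>J'. P J' \<Longrightarrow> card J \<le> card J'"
    using ex_has_least_nat[of P "{..<n}" card] by blast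
  have fin: "finite J" using J finite_subset unfolding P_def by blast
  have "\<exists>v\<in>V. \<forall>i\<in>J. v i = unitv j i" if j: "j \<in> J" for j
  proof -
    have "\<not> P (J - {j})" using min[of "J - {j}"] card_Diff1_less[OF fin j] by linarith
    moreover have "J - {j} \<subseteq> {..<n}" using J unfolding P_def by blast
    ultimately obtain x where x: "x \<in> V" "\<forall>i\<in>J - {j}. x i = 0" "x \<noteq> 0"
      unfolding P_def by blast
    then have xj: "x j \<noteq> 0" using J unfolding P_def by blast
    have "vscale (inverse (x j)) x \<in> V" using x(1) V(2) by (simp add: qv.subspace_def)
    moreover have "\<forall>i\<in>J. vscale (inverse (x j)) x i = unitv j i"
      using x(2) xj by (auto simp: vscale_def unitv_def)
    ultimately show ?thesis by blast
  qed
  then show ?thesis using that J unfolding P_def by blast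
qed

text \<open>The dual vectors give \<open>card J \<le> vdim V\<close>, hence
  \<open>card J \<le> vdim V'\<close>. The projection \<open>r\<close> onto the coordinates in
  \<open>J\<close> is injective on \<open>V'\<close>, so by dimension it is onto.\<close>

lemma pivots_transfer:
  fixes V V' :: "(nat \<Rightarrow> 'k::field) set"
  assumes V: "V \<subseteq> qvec n" "qv.subspace V" and V': "V' \<subseteq> qvec n" "qv.subspace V'"
    and J: "J \<subseteq> {..<n}" and dual: "\<And>j. j \<in> J \<Longrightarrow> \<exists>v\<in>V. \<forall>i\<in>J. v i = unitv j i"
    and inj: "\<And>x. x \<in> V' \<Longrightarrow> (\<forall>j\<in>J. x j = 0) \<Longrightarrow> x = 0"
    and dim: "vdim V \<le> vdim V'"
  shows "\<exists>v\<in>V'. \<forall>j\<in>J. v j = x j"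
proof -
  define r where "r = (\<lambda>(x :: nat \<Rightarrow> 'k) i. if i \<in> J then x i else 0)"
  have lin_r: "Vector_Spaces.linear vscale vscale r"
    by unfold_locales (auto simp: r_def vscale_def fun_eq_iff algebra_simps)
  interpret r: Vector_Spaces.linear vscale vscale r by (fact lin_r)
  have finJ: "finite J" using J finite_subset by blast
  let ?E = "unitv ` J :: (nat \<Rightarrow> 'k) set"
  have cardE: "card ?E = card J" by (rule card_image) (rule inj_on_subset[OF inj_unitv], simp)
  have rE: "r y \<in> qv.span ?E" for y
    by (rule supported_in_span_unitv[OF finJ]) (simp add: r_def)
  obtain B where B: "B \<subseteq> V" "V \<subseteq> qv.span B" "card B = vdim V" "finite B"
    using subspace_basis_qvec[OF V(1)] by metis
  have "?E \<subseteq> qv.span (r ` B)"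
  proof clarify
    fix j assume "j \<in> J"
    then obtain v where v: "v \<in> V" "\<forall>i\<in>J. v i = unitv j i" using dual by blast
    have "r v = unitv j" using v(2) \<open>j \<in> J\<close> by (auto simp: r_def unitv_def fun_eq_iff)
    moreover have "r v \<in> qv.span (r ` B)" using v(1) B(2) by (auto simp: r.span_image)
    ultimately show "unitv j \<in> qv.span (r ` B)" by simp
  qed
  then have "card ?E \<le> card (r ` B)"
    using qv.independent_span_bound[OF _ independent_unitv] B(4) by blast
  also have "\<dots> \<le> card B" by (rule card_image_le[OF B(4)])
  finally have cJ: "card J \<le> vdim V'" using cardE B(3) dim by simp
  obtain B' where B': "B' \<subseteq> V'" "qv.independent B'" "V' \<subseteq> qv.span B'" "card B' = vdim V'" "finite B'"
    using subspace_basis_qvec[OF V'(1)] by metis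
  have spB': "qv.span B' = V'" using B' V'(2) by (simp add: qv.span_subspace)
  have inj_r: "inj_on r (qv.span B')"
    unfolding spB'
  proof (rule inj_onI)
    fix x y assume xy: "x \<in> V'" "y \<in> V'" "r x = r y"
    have "x - y \<in> V'" using xy V'(2) by (simp add: qv.subspace_diff)
    moreover have "(x - y) j = 0" if "j \<in> J" for j
      using fun_cong[OF xy(3), of j] that by (simp add: r_def)
    ultimately show "x = y" using inj[of "x - y"] by simp
  qed
  have ind: "qv.independent (r ` B')"
    using r.dependent_inj_imageD inj_r B'(2) by blast
  have cB': "card (r ` B') = card B'"
    by (rule card_image) (rule inj_on_subset[OF inj_r qv.span_superset])
  \<comment> \<open>Otherwise adjoining \<open>unitv j\<close> to the image of the basis would give
    more than \<open>card J\<close> independent vectors in a space spanned by \<open>card J\<close>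
    vectors.\<close>
  have "unitv j \<in> qv.span (r ` B')" if "j \<in> J" for j
  proof (rule ccontr)
    assume nin: "unitv j \<notin> qv.span (r ` B')"
    then have "qv.independent (insert (unitv j) (r ` B'))"
      by (rule qv.independent_insertI[OF _ ind])
    moreover have "insert (unitv j) (r ` B') \<subseteq> qv.span ?E"
      using rE that by (auto intro: qv.span_base)
    ultimately have "card (insert (unitv j) (r ` B')) \<le> card ?E"
      using qv.independent_span_bound finJ by blast
    moreover have "unitv j \<notin> r ` B'"
      using nin qv.span_base[of "unitv j" "r ` B'"] by argo
    ultimately show False using cB' B'(4,5) cJ cardE by simp
  qed
  then have "qv.span ?E \<subseteq> r ` V'"
    using qv.span_minimal[of ?E "qv.span (r ` B')"] qv.subspace_span[of "r ` B'"]
    by (simp add: image_subset_iff r.span_image spB')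
  then obtain v where "v \<in> V'" "r x = r v" using rE[of x] by blast
  then have "v \<in> V' \<and> (\<forall>j\<in>J. v j = x j)" by (auto simp: r_def fun_eq_iff split: if_splits)
  then show ?thesis by blast
qed

section \<open>The skew form attached to a linear form, and its kernel\<close>

lemma qbr_add_left: "qbr n c (x + y) z = qbr n c x z + qbr n c y z"
  by (auto simp: qbr_def fun_eq_iff sum.distrib algebra_simps)

lemma qbr_add_right: "qbr n c x (y + z) = qbr n c x y + qbr n c x z"
  by (auto simp: qbr_def fun_eq_iff sum.distrib algebra_simps)

lemma lie_skew:
  assumes "is_lie_algebra n c" "x \<in> qvec n" "y \<in> qvec n"
  shows "qbr n c x y = - qbr n c y x"
proof -
  have sq: "qbr n c u u = 0" if "u \<in> qvec n" for u
    using assms(1) that by (simp add: is_lie_algebra_def zero_fun_def)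
  have "x + y \<in> qvec n" using assms by (simp add: qvec_def)
  from sq[OF this] show ?thesis
    by (simp add: qbr_add_left qbr_add_right sq assms eq_neg_iff_add_eq_0 add.commute)
qed

text \<open>The Gram matrix of the skew form sending \<open>x, y\<close> to
  \<open>xi([x, y])\<close>.\<close>

definition coadj_mat :: "nat \<Rightarrow> (nat \<Rightarrow> nat \<Rightarrow> nat \<Rightarrow> 'a::comm_ring_1) \<Rightarrow> (nat \<Rightarrow> 'a) \<Rightarrow> nat \<Rightarrow> nat \<Rightarrow> 'a" where
  "coadj_mat n c xi i j = (\<Sum>l<n. c i j l * xi l)"

lemma pairing_qbr: "pairing n xi (qbr n c x y) = dotp n x (mvec n (coadj_mat n c xi) y)"
proof -
  have "pairing n xi (qbr n c x y) = (\<Sum>l<n. \<Sum>i<n. \<Sum>j<n. x i * (c i j l * xi l * y j))"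
    by (simp add: pairing_def qbr_def sum_distrib_left mult_ac)
  also have "\<dots> = (\<Sum>i<n. \<Sum>j<n. \<Sum>l<n. x i * (c i j l * xi l * y j))"
    by (subst sum.swap, rule sum.cong[OF refl], rule sum.swap)
  also have "\<dots> = dotp n x (mvec n (coadj_mat n c xi) y)"
    by (simp add: dotp_def mvec_def coadj_mat_def sum_distrib_left sum_distrib_right)
  finally show ?thesis .
qed

lemma dotp_unitv: "i < n \<Longrightarrow> dotp n (unitv i) x = x i"
proof -
  assume "i < n"
  have "dotp n (unitv i) x = (\<Sum>k<n. if i = k then x k else 0)"
    unfolding dotp_def by (intro sum.cong) (auto simp: unitv_def)
  then show ?thesis using \<open>i < n\<close> by simp
qed

lemma mvec_coadj_mat:
  "i < n \<Longrightarrow> mvec n (coadj_mat n c xi) y i = pairing n xi (qbr n c (unitv i) y)"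
  by (simp add: pairing_qbr dotp_unitv)

lemma mvec_unitv: "j < n \<Longrightarrow> mvec n A (unitv j) i = A i j"
  using dotp_unitv[of j n "A i"] by (simp add: mvec_def dotp_def mult.commute)

lemma pairing_uminus: "pairing n xi (- x) = - pairing n xi x"
  by (simp add: pairing_def sum_negf)

lemma coadj_mat_skew:
  assumes "is_lie_algebra n c" "i < n" "j < n"
  shows "coadj_mat n c xi i j = - coadj_mat n c xi j i"
proof -
  have *: "coadj_mat n c xi i j = pairing n xi (qbr n c (unitv i) (unitv j))" if "i < n" "j < n" for i j
    using that by (simp add: mvec_coadj_mat[symmetric] mvec_unitv)
  show ?thesis
    using lie_skew[OF assms(1) unitv_qvec[OF assms(2)] unitv_qvec[OF assms(3)]]
    by (simp add: * assms pairing_uminus)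
qed

text \<open>The stabiliser is the left kernel of the form, whereas \<open>mvec\<close> computes the
  right kernel; skewness identifies the two.\<close>

lemma stab_eq_kernel:
  assumes "is_lie_algebra n c"
  shows "stab n c xi = {x \<in> qvec n. \<forall>i<n. mvec n (coadj_mat n c xi) x i = 0}"
proof -
  have "(\<forall>y\<in>qvec n. pairing n xi (qbr n c x y) = 0) \<longleftrightarrow> (\<forall>i<n. mvec n (coadj_mat n c xi) x i = 0)"
    if x: "x \<in> qvec n" for x
  proof
    assume "\<forall>y\<in>qvec n. pairing n xi (qbr n c x y) = 0"
    then have "pairing n xi (qbr n c x (unitv i)) = 0" if "i < n" for i
      using unitv_qvec[OF that] by blast
    then show "\<forall>i<n. mvec n (coadj_mat n c xi) x i = 0"
      using lie_skew[OF assms unitv_qvec x] by (simp add: mvec_coadj_mat pairing_uminus)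
  next
    assume *: "\<forall>i<n. mvec n (coadj_mat n c xi) x i = 0"
    show "\<forall>y\<in>qvec n. pairing n xi (qbr n c x y) = 0"
    proof
      fix y :: "nat \<Rightarrow> 'a" assume "y \<in> qvec n"
      then have "pairing n xi (qbr n c x y) = - pairing n xi (qbr n c y x)"
        using lie_skew[OF assms x] by (simp add: pairing_uminus)
      also have "pairing n xi (qbr n c y x) = 0" using * by (simp add: pairing_qbr dotp_def)
      finally show "pairing n xi (qbr n c x y) = 0" by simp
    qed
  qed
  then show ?thesis unfolding stab_def by blast
qed

lemma mvec_add: "mvec n A (x + y) i = mvec n A x i + mvec n A y i"
  by (simp add: mvec_def sum.distrib algebra_simps)

lemma subspace_stab: "is_lie_algebra n c \<Longrightarrow> qv.subspace (stab n c xi)"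
  unfolding stab_eq_kernel qv.subspace_def
  by (auto simp: qvec_def mvec_add vscale_def[abs_def] mvec_scale) (simp add: mvec_def)

text \<open>\<open>J\<close> is a set of pivots for the stabiliser of \<open>rho\<close>. If
  \<open>A + 1_J\<close> is injective for another form \<open>eta\<close>, then the stabiliser of
  \<open>eta\<close> has no nonzero vector vanishing on \<open>J\<close>. Regularity of
  \<open>rho\<close> bounds its dimension from below, so \<open>pivots_transfer\<close>
  applies.\<close>

lemma regular_pivots:
  fixes c :: "nat \<Rightarrow> nat \<Rightarrow> nat \<Rightarrow> 'k::field"
  assumes lie: "is_lie_algebra n c" and reg: "rho \<in> regular n c"
  obtains J where "inj_mat n (add_diag J (coadj_mat n c rho))"
    "\<And>eta x. inj_mat n (add_diag J (coadj_mat n c eta)) \<Longrightarrow>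
      \<exists>v. (\<forall>i<n. mvec n (coadj_mat n c eta) v i = 0) \<and> (\<forall>j<n. j \<in> J \<longrightarrow> v j = x j)"
proof -
  have sub: "stab n c xi \<subseteq> qvec n" for xi by (auto simp: stab_def)
  obtain J where J: "J \<subseteq> {..<n}"
    and inj: "\<And>x. x \<in> stab n c rho \<Longrightarrow> (\<forall>j\<in>J. x j = 0) \<Longrightarrow> x = 0"
    and dual: "\<And>j. j \<in> J \<Longrightarrow> \<exists>v\<in>stab n c rho. \<forall>i\<in>J. v i = unitv j i"
    using pivots_exist[OF sub subspace_stab[OF lie]] by metis
  let ?A = "coadj_mat n c rho"
  have "inj_mat n (add_diag J ?A)"
    unfolding inj_mat_def
  proof (intro allI impI)
    fix x :: "nat \<Rightarrow> 'k" and i0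
    assume x: "\<forall>i<n. mvec n (add_diag J ?A) x i = 0" and i0: "i0 < n"
    \<comment> \<open>Pair the equation \<open>(A + 1_J) x = 0\<close> with the stabiliser vector
      \<open>v\<close> dual to \<open>j\<close>: the term \<open>v^T A x = - (A v)^T x\<close>
      vanishes and only \<open>x j\<close> remains.\<close>
    have xJ: "x j = 0" if j: "j \<in> J" for j
    proof -
      obtain v where v: "v \<in> stab n c rho" "\<forall>i\<in>J. v i = unitv j i" using dual[OF j] by blast
      have "0 = dotp n v (mvec n (add_diag J ?A) x)" using x by (simp add: dotp_def)
      also have "\<dots> = dotp n v (mvec n ?A x) + (\<Sum>i<n. if j = i then x i else 0)"
        unfolding dotp_def sum.distrib[symmetric]
        by (intro sum.cong refl) (use v(2) j in \<open>auto simp: mvec_add_diag algebra_simps unitv_def\<close>)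
      also have "dotp n v (mvec n ?A x) = - dotp n (mvec n ?A v) x"
        by (rule dotp_mvec_skew[OF coadj_mat_skew[OF lie]])
      also have "\<dots> = 0" using v(1) by (simp add: stab_eq_kernel[OF lie] dotp_def)
      finally show "x j = 0" using j J by auto
    qed
    \<comment> \<open>\<open>inj_mat\<close> ranges over arbitrary functions, while stabiliser
      vectors must vanish from index \<open>n\<close> on, hence the truncation.\<close>
    define x' where "x' = (\<lambda>i. if i < n then x i else 0)"
    have "mvec n ?A x' i = 0" if i: "i < n" for i
    proof -
      have "mvec n ?A x' i = mvec n ?A x i" by (rule mvec_cong) (simp add: x'_def)
      also have "\<dots> = 0" using x xJ i by (auto simp: mvec_add_diag split: if_splits)
      finally show ?thesis .
    qed
    then have "x' \<in> stab n c rho" by (auto simp: stab_eq_kernel[OF lie] x'_def qvec_def)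
    then have "x' = 0" by (rule inj) (simp add: x'_def xJ)
    then have "x' i0 = 0" by simp
    then show "x i0 = 0" using i0 by (simp add: x'_def)
  qed
  moreover have "\<exists>v. (\<forall>i<n. mvec n (coadj_mat n c eta) v i = 0) \<and> (\<forall>j<n. j \<in> J \<longrightarrow> v j = x j)"
    if M: "inj_mat n (add_diag J (coadj_mat n c eta))" for eta x
  proof -
    have "\<exists>v\<in>stab n c eta. \<forall>j\<in>J. v j = x j"
    proof (rule pivots_transfer[OF sub subspace_stab[OF lie] sub subspace_stab[OF lie] J dual])
      fix y assume y: "y \<in> stab n c eta" "\<forall>j\<in>J. y j = 0"
      have "\<forall>i<n. mvec n (add_diag J (coadj_mat n c eta)) y i = 0"
        using y by (auto simp: mvec_add_diag stab_eq_kernel[OF lie])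
      then have "\<forall>i<n. y i = 0" using M unfolding inj_mat_def by blast
      moreover have "y i = 0" if "n \<le> i" for i
        using y(1) sub[of eta] that by (auto simp: qvec_def)
      ultimately have "y i = 0" for i by (cases "i < n") auto
      then show "y = 0" by (simp add: fun_eq_iff)
    next
      show "vdim (stab n c rho) \<le> vdim (stab n c eta)" using reg by (simp add: regular_def)
    qed
    then show ?thesis using J by (auto simp: stab_eq_kernel[OF lie])
  qed
  ultimately show ?thesis using that by blast
qed

section \<open>Brackets of invariants as coefficients of a skew polynomial form\<close>

lemma shifted_monoms_mult:
  fixes f :: "'b \<Rightarrow> 'a::comm_ring_1"
  shows "(\<Sum>b\<in>S. monom (f b) (d b)) * (\<Sum>a\<in>T. monom (g a) (e a))
    = (\<Sum>b\<in>S. \<Sum>a\<in>T. monom (f b * g a) (d b + e a))"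
  by (simp add: sum_product mult_monom)

lemma sum_monom: "(\<Sum>i\<in>S. monom (f i) k) = monom (\<Sum>i\<in>S. f i) k"
  by (induction S rule: infinite_finite_induct) (auto simp: add_monom)

lemma mvec_monoms:
  "mvec n (\<lambda>i j. \<Sum>b\<in>S. monom (A b i j) (d b)) (\<lambda>j. \<Sum>a\<in>T. monom (y a j) (e a)) i
    = (\<Sum>b\<in>S. \<Sum>a\<in>T. monom (mvec n (A b) (y a) i) (d b + e a))"
proof -
  have "mvec n (\<lambda>i j. \<Sum>b\<in>S. monom (A b i j) (d b)) (\<lambda>j. \<Sum>a\<in>T. monom (y a j) (e a)) i
    = (\<Sum>j<n. \<Sum>b\<in>S. \<Sum>a\<in>T. monom (A b i j * y a j) (d b + e a))"
    unfolding mvec_def shifted_monoms_mult ..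
  also have "\<dots> = (\<Sum>b\<in>S. \<Sum>a\<in>T. \<Sum>j<n. monom (A b i j * y a j) (d b + e a))"
    by (subst sum.swap, rule sum.cong[OF refl], rule sum.swap)
  finally show ?thesis by (simp add: sum_monom mvec_def)
qed

lemma dotp_monoms:
  "dotp n (\<lambda>j. \<Sum>a\<in>S. monom (x a j) (d a)) (\<lambda>j. \<Sum>b\<in>T. monom (y b j) (e b))
    = (\<Sum>a\<in>S. \<Sum>b\<in>T. monom (dotp n (x a) (y b)) (d a + e b))"
proof -
  have "dotp n (\<lambda>j. \<Sum>a\<in>S. monom (x a j) (d a)) (\<lambda>j. \<Sum>b\<in>T. monom (y b j) (e b))
    = (\<Sum>j<n. \<Sum>a\<in>S. \<Sum>b\<in>T. monom (x a j * y b j) (d a + e b))"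
    unfolding dotp_def shifted_monoms_mult ..
  also have "\<dots> = (\<Sum>a\<in>S. \<Sum>b\<in>T. \<Sum>j<n. monom (x a j * y b j) (d a + e b))"
    by (subst sum.swap, rule sum.cong[OF refl], rule sum.swap)
  finally show ?thesis by (simp add: sum_monom dotp_def)
qed

text \<open>\<open>Xi b\<close> is the degree \<open>b\<close> part of a point, and
  \<open>y1 a\<close>, \<open>y2 a\<close> are the degree \<open>a\<close> parts of two
  differentials. The hypothesis for \<open>k\<close> expresses invariance under
  \<open>x t^(-k)\<close> and kills the coefficient of \<open>w^(N-k)\<close> in \<open>A p\<close>.
  The conclusion concerns the coefficient of \<open>w^(2N)\<close> in \<open>p1^T A p2\<close>,
  which is divisible by \<open>w^(2N+2)\<close>.\<close>

lemma invariant_brackets_vanish: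
  fixes c :: "nat \<Rightarrow> nat \<Rightarrow> nat \<Rightarrow> 'k::field_char_0" and Xi :: "nat \<Rightarrow> nat \<Rightarrow> 'k"
  assumes lie: "is_lie_algebra n c"
    and J0: "inj_mat n (add_diag J (coadj_mat n c (Xi 0)))"
    and J: "\<And>eta x. inj_mat n (add_diag J (coadj_mat n c eta)) \<Longrightarrow>
      \<exists>v. (\<forall>i<n. mvec n (coadj_mat n c eta) v i = 0) \<and> (\<forall>j<n. j \<in> J \<longrightarrow> v j = x j)"
    and inv1: "\<And>k x. k \<le> N \<Longrightarrow> x \<in> qvec n \<Longrightarrow> (\<Sum>a=k..N. pairing n (Xi (a - k)) (qbr n c x (y1 a))) = 0"
    and inv2: "\<And>k x. k \<le> N \<Longrightarrow> x \<in> qvec n \<Longrightarrow> (\<Sum>a=k..N. pairing n (Xi (a - k)) (qbr n c x (y2 a))) = 0"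
  shows "(\<Sum>a\<le>N. \<Sum>b\<le>N. pairing n (Xi (a + b)) (qbr n c (y1 a) (y2 b))) = 0"
proof -
  define C where "C b = coadj_mat n c (Xi b)" for b :: nat
  \<comment> \<open>Degrees above \<open>2 * N\<close> never meet two differentials of degree at
    most \<open>N\<close>, so the point is truncated there.\<close>
  define A where "A = (\<lambda>i j. \<Sum>b\<le>2*N. monom (C b i j) b)"
  define p where "p y = (\<lambda>j. \<Sum>a\<le>N. monom (y a j) (N - a))" for y :: "nat \<Rightarrow> nat \<Rightarrow> 'k"
  have Ap: "mvec n A (p y) i = (\<Sum>b\<le>2*N. \<Sum>a\<le>N. monom (mvec n (C b) (y a) i) (b + (N - a)))" for y i
    unfolding A_def p_def by (rule mvec_monoms)
  have low: "monom 1 (Suc N) dvd mvec n A (p y) i"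
    if inv: "\<And>k x. k \<le> N \<Longrightarrow> x \<in> qvec n \<Longrightarrow> (\<Sum>a=k..N. pairing n (Xi (a - k)) (qbr n c x (y a))) = 0"
      and i: "i < n" for y i
    unfolding monom_1_dvd_iff'
  proof (intro allI impI)
    fix e assume e: "e < Suc N"
    \<comment> \<open>For \<open>a \<le> N\<close>, the equation \<open>b + (N - a) = e\<close>
      means \<open>b = a - k\<close>. Since subtraction on naturals truncates, the condition
      \<open>k \<le> a\<close> has to be kept alongside.\<close>
    define k where "k = N - e"
    have "coeff (mvec n A (p y) i) e
        = (\<Sum>b\<le>2*N. \<Sum>a\<le>N. if b + (N - a) = e then mvec n (C b) (y a) i else 0)"
      by (simp add: Ap coeff_sum)
    also have "\<dots> = (\<Sum>a\<le>N. \<Sum>b\<le>2*N. if b + (N - a) = e then mvec n (C b) (y a) i else 0)"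
      by (rule sum.swap)
    also have "\<dots> = (\<Sum>a\<le>N. if k \<le> a then mvec n (C (a - k)) (y a) i else 0)"
    proof (intro sum.cong refl)
      fix a assume a: "a \<in> {..N}"
      have "(\<Sum>b\<le>2*N. if b + (N - a) = e then mvec n (C b) (y a) i else 0)
          = (\<Sum>b\<le>2*N. if a - k = b then (if k \<le> a then mvec n (C b) (y a) i else 0) else 0)"
        using a e by (intro sum.cong) (auto simp: k_def)
      also have "\<dots> = (if k \<le> a then mvec n (C (a - k)) (y a) i else 0)"
        using a by auto
      finally show "(\<Sum>b\<le>2*N. if b + (N - a) = e then mvec n (C b) (y a) i else 0) = \<dots>" .
    qed
    also have "\<dots> = (\<Sum>a=k..N. mvec n (C (a - k)) (y a) i)"
    proof -
      have "{a \<in> {..N}. k \<le> a} = {k..N}" by auto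
      then show ?thesis by (simp add: sum.inter_filter[symmetric])
    qed
    also have "\<dots> = 0"
      using inv[of k "unitv i"] unitv_qvec[OF i] i by (simp add: C_def mvec_coadj_mat k_def)
    finally show "coeff (mvec n A (p y) i) e = 0" .
  qed
  \<comment> \<open>At each \<open>w\<close> the matrix is again the one of a linear form on
    \<open>q\<close>, so the assumption \<open>J\<close>, made for all forms, applies along the
    whole curve.\<close>
  have pA: "poly_mat A w = coadj_mat n c (\<lambda>l. \<Sum>b\<le>2*N. Xi b l * w ^ b)" for w
  proof (intro ext)
    fix i j
    have "poly_mat A w i j = (\<Sum>b\<le>2*N. \<Sum>l<n. c i j l * (Xi b l * w ^ b))"
      by (simp add: poly_mat_def A_def C_def coadj_mat_def poly_sum poly_monom sum_distrib_right mult.assoc)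
    also have "\<dots> = (\<Sum>l<n. \<Sum>b\<le>2*N. c i j l * (Xi b l * w ^ b))"
      by (rule sum.swap)
    finally show "poly_mat A w i j = coadj_mat n c (\<lambda>l. \<Sum>b\<le>2*N. Xi b l * w ^ b) i j"
      by (simp add: coadj_mat_def sum_distrib_left)
  qed
  have Xi0: "(\<lambda>l. \<Sum>b\<le>2*N. Xi b l * 0 ^ b) = Xi 0"
    by (auto simp: power_0_left fun_eq_iff if_distrib[of "(*) _"] cong: if_cong)
  have "monom 1 (2 * Suc N) dvd dotp n (p y1) (mvec n A (p y2))"
  proof (rule skew_form_high_order[where J = J])
    fix i j assume "i < n" "j < n"
    then show "A i j = - A j i"
      by (simp add: A_def C_def coadj_mat_skew[OF lie, of i j] sum_negf[symmetric] minus_monom)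
  next
    show "inj_mat n (add_diag J (poly_mat A 0))" using J0 by (simp add: pA Xi0)
  next
    show "\<exists>v. (\<forall>i<n. mvec n (poly_mat A w) v i = 0) \<and> (\<forall>j<n. j \<in> J \<longrightarrow> v j = x j)"
      if "inj_mat n (add_diag J (poly_mat A w))" for w x
      using J that unfolding pA by blast
  qed (use low inv1 inv2 in blast)+
  then have "0 = coeff (dotp n (p y1) (mvec n A (p y2))) (2 * N)"
    unfolding monom_1_dvd_iff' by simp
  also have "mvec n A (p y2) = (\<lambda>i. \<Sum>(b,a)\<in>{..2*N} \<times> {..N}. monom (mvec n (C b) (y2 a) i) (b + (N - a)))"
    by (intro ext) (simp only: Ap sum.cartesian_product)
  also have "dotp n (p y1) \<dots> = (\<Sum>a'\<le>N. \<Sum>(b,a)\<in>{..2*N} \<times> {..N}.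
      monom (dotp n (y1 a') (mvec n (C b) (y2 a))) ((N - a') + (b + (N - a))))"
    using dotp_monoms[of n y1 "\<lambda>a. N - a" "{..N}" "\<lambda>x. mvec n (C (fst x)) (y2 (snd x))"
        "\<lambda>x. fst x + (N - snd x)" "{..2*N} \<times> {..N}"]
    by (simp add: p_def case_prod_beta)
  also have "coeff \<dots> (2*N) = (\<Sum>a'\<le>N. \<Sum>b\<le>2*N. \<Sum>a\<le>N.
      if (N - a') + (b + (N - a)) = 2*N then dotp n (y1 a') (mvec n (C b) (y2 a)) else 0)"
    by (simp only: coeff_sum coeff_monom case_prod_beta sum.cartesian_product fst_conv snd_conv)
      (intro sum.cong refl, auto)
  \<comment> \<open>With \<open>a\<close> and \<open>a'\<close> at most \<open>N\<close>, total
    exponent \<open>2 * N\<close> is equivalent to \<open>b = a' + a\<close>.\<close>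
  also have "\<dots> = (\<Sum>a'\<le>N. \<Sum>a\<le>N. \<Sum>b\<le>2*N.
      if a' + a = b then dotp n (y1 a') (mvec n (C b) (y2 a)) else 0)"
    by (subst sum.swap[of _ "{..2*N}"], intro sum.cong refl) auto
  also have "\<dots> = (\<Sum>a'\<le>N. \<Sum>a\<le>N. dotp n (y1 a') (mvec n (C (a' + a)) (y2 a)))"
    by (intro sum.cong refl) (simp add: sum.delta')
  finally show ?thesis by (simp add: pairing_qbr C_def)
qed

section \<open>Evaluation and derivatives of polynomials\<close>

abbreviation "lkp \<equiv> Poly_Mapping.lookup"

lemma poly_mapping_sum_singles:
  fixes f :: "'a \<Rightarrow>\<^sub>0 'b::comm_monoid_add"
  shows "(\<Sum>k\<in>Poly_Mapping.keys f. Poly_Mapping.single k (lkp f k)) = f"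
proof (rule poly_mapping_eqI)
  fix k
  have "lkp (\<Sum>k\<in>Poly_Mapping.keys f. Poly_Mapping.single k (lkp f k)) k
      = (\<Sum>k'\<in>Poly_Mapping.keys f. if k' = k then lkp f k' else 0)"
    by (simp add: lookup_sum lookup_single when_def)
  also have "\<dots> = lkp f k" by (simp add: sum.delta in_keys_iff)
  finally show "lkp (\<Sum>k\<in>Poly_Mapping.keys f. Poly_Mapping.single k (lkp f k)) k = lkp f k" .
qed

lemma poly_mapping_single_induct [case_names zero single add]:
  fixes f :: "'a \<Rightarrow>\<^sub>0 'b::comm_monoid_add"
  assumes "P 0" "\<And>k a. P (Poly_Mapping.single k a)" "\<And>f g. P f \<Longrightarrow> P g \<Longrightarrow> P (f + g)"
  shows "P f"
proof -
  have "P (\<Sum>k\<in>S. Poly_Mapping.single k (lkp f k))" for S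
    by (induction S rule: infinite_finite_induct) (use assms in auto)
  then show ?thesis using poly_mapping_sum_singles[of f] by metis
qed

definition mono_ev :: "('v \<Rightarrow> 'a::comm_ring_1) \<Rightarrow> ('v \<Rightarrow>\<^sub>0 nat) \<Rightarrow> 'a" where
  "mono_ev \<phi> m = (\<Prod>v\<in>Poly_Mapping.keys m. \<phi> v ^ lkp m v)"

lemma mono_ev_superset:
  assumes "finite S" "Poly_Mapping.keys m \<subseteq> S"
  shows "mono_ev \<phi> m = (\<Prod>v\<in>S. \<phi> v ^ lkp m v)"
  unfolding mono_ev_def
  by (rule prod.mono_neutral_left) (use assms in \<open>auto simp: in_keys_iff\<close>)

lemma mono_ev_0 [simp]: "mono_ev \<phi> 0 = 1"
  by (simp add: mono_ev_def)

lemma mono_ev_single [simp]: "mono_ev \<phi> (Poly_Mapping.single v k) = \<phi> v ^ k"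
  by (simp add: mono_ev_def)

lemma mono_ev_add: "mono_ev \<phi> (m + m') = mono_ev \<phi> m * mono_ev \<phi> m'"
proof -
  let ?S = "Poly_Mapping.keys m \<union> Poly_Mapping.keys m'"
  have "mono_ev \<phi> (m + m') = (\<Prod>v\<in>?S. \<phi> v ^ lkp (m + m') v)"
    by (rule mono_ev_superset) (simp_all add: keys_add)
  also have "\<dots> = (\<Prod>v\<in>?S. \<phi> v ^ lkp m v) * (\<Prod>v\<in>?S. \<phi> v ^ lkp m' v)"
    by (simp add: lookup_add power_add prod.distrib)
  also have "\<dots> = mono_ev \<phi> m * mono_ev \<phi> m'"
    by (subst (1 2) mono_ev_superset[where S = ?S]) auto
  finally show ?thesis .
qed

text \<open>Substitution of one-variable polynomials for the variables, that is, restriction of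
  \<open>f\<close> to a curve of points; \<open>ev\<close> is evaluation at a single point.\<close>

definition pev :: "(nat \<times> int \<Rightarrow> 'k::field poly) \<Rightarrow> 'k spoly \<Rightarrow> 'k poly" where
  "pev \<phi> f = (\<Sum>m\<in>Poly_Mapping.keys f. [:lkp f m:] * mono_ev \<phi> m)"

definition ev :: "(nat \<times> int \<Rightarrow> 'k::field) \<Rightarrow> 'k spoly \<Rightarrow> 'k" where
  "ev \<phi> f = (\<Sum>m\<in>Poly_Mapping.keys f. lkp f m * mono_ev \<phi> m)"

lemma poly_pev: "poly (pev \<phi> f) s = ev (\<lambda>v. poly (\<phi> v) s) f"
  by (simp add: pev_def ev_def poly_sum mono_ev_def poly_prod)

lemma ev_single [simp]: "ev \<phi> (Poly_Mapping.single m a) = a * mono_ev \<phi> m"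
  by (simp add: ev_def)

lemma ev_0 [simp]: "ev \<phi> 0 = 0"
  by (simp add: ev_def)

lemma ev_add [simp]: "ev \<phi> (f + g) = ev \<phi> f + ev \<phi> g"
  unfolding ev_def by (rule setsum_keys_plus_distrib) (simp_all add: distrib_right)

lemma ev_mult [simp]: "ev \<phi> (f * g) = ev \<phi> f * ev \<phi> g"
proof (induction f rule: poly_mapping_single_induct)
  case (single m a)
  show ?case
    by (induction g rule: poly_mapping_single_induct)
      (simp_all add: mult_single mono_ev_add distrib_left mult.assoc mult.left_commute)
qed (simp_all add: distrib_right)

lemma ev_sum [simp]: "ev \<phi> (\<Sum>i\<in>S. f i) = (\<Sum>i\<in>S. ev \<phi> (f i))"
  by (induction S rule: infinite_finite_induct) auto

lemma ev_const [simp]: "ev \<phi> (const a) = a"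
  by (simp add: const_def)

lemma ev_var [simp]: "ev \<phi> (var v) = \<phi> v"
  by (simp add: var_def)

lemma ev_linp: "ev \<phi> (linp x) = (\<Sum>v\<in>Poly_Mapping.keys x. lkp x v * \<phi> v)"
  by (simp add: linp_def)

text \<open>Kronecker substitution: base \<open>N\<close> digits give weights separating the monomials.\<close>

lemma separating_weights:
  fixes V :: "'v set" and N :: nat
  assumes "finite V"
  shows "\<exists>wt :: 'v \<Rightarrow> nat. \<forall>a b. (\<forall>v\<in>V. a v < N \<and> b v < N) \<longrightarrow>
    (\<Sum>v\<in>V. wt v * a v) = (\<Sum>v\<in>V. wt v * b v) \<longrightarrow> (\<forall>v\<in>V. a v = b v)"
  using assms
proof (induction V)
  case empty
  then show ?case by simp
next
  case (insert u V)
  then obtain wt :: "'v \<Rightarrow> nat" where wt: "\<And>a b. (\<forall>v\<in>V. a v < N \<and> b v < N) \<Longrightarrow>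
    (\<Sum>v\<in>V. wt v * a v) = (\<Sum>v\<in>V. wt v * b v) \<Longrightarrow> (\<forall>v\<in>V. a v = b v)" by blast
  \<comment> \<open>The new variable \<open>u\<close> becomes the lowest digit in base
    \<open>N\<close>, and the old digits are shifted up by one place; reduction mod \<open>N\<close>
    then recovers the exponent of \<open>u\<close>.\<close>
  define wt' where "wt' v = (if v = u then 1 else N * wt v)" for v
  have sum: "(\<Sum>v\<in>insert u V. wt' v * a v) = a u + N * (\<Sum>v\<in>V. wt v * a v)" for a
  proof -
    have "(\<Sum>v\<in>V. wt' v * a v) = (\<Sum>v\<in>V. N * (wt v * a v))"
      using insert.hyps by (intro sum.cong) (auto simp: wt'_def)
    then show ?thesis using insert.hyps by (simp add: wt'_def sum_distrib_left)
  qed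
  have "\<forall>v\<in>insert u V. a v = b v"
    if ab: "\<forall>v\<in>insert u V. a v < N \<and> b v < N"
      and eq: "(\<Sum>v\<in>insert u V. wt' v * a v) = (\<Sum>v\<in>insert u V. wt' v * b v)" for a b
  proof -
    let ?s = "\<lambda>a. \<Sum>v\<in>V. wt v * a v"
    have e: "a u + N * ?s a = b u + N * ?s b" using eq unfolding sum .
    have lt: "a u < N" "b u < N" using ab by auto
    have "(a u + N * ?s a) mod N = a u" "(b u + N * ?s b) mod N = b u" using lt by simp_all
    then have au: "a u = b u" using e by simp
    then have "?s a = ?s b" using e lt by simp
    then show ?thesis using wt[of a b] ab au by auto
  qed
  then show ?case by blast
qed

text \<open>Substituting the power \<open>wt v\<close> of one indeterminate for each variable
  \<open>v\<close> sends the monomials of \<open>f\<close> to distinct powers, so nothing cancels. A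
  nonzero polynomial in one variable has a non-root in characteristic 0.\<close>

lemma spoly_nonzero_point:
  fixes f :: "'k::field_char_0 spoly"
  assumes "f \<noteq> 0"
  shows "\<exists>\<phi>. ev \<phi> f \<noteq> 0"
proof -
  have pv: "finite (pvars f)" by (simp add: pvars_def)
  \<comment> \<open>The sum of all exponents in \<open>f\<close>, plus one, exceeds each of them, so
    all exponents are valid digits.\<close>
  define N where "N = Suc (\<Sum>m\<in>Poly_Mapping.keys f. \<Sum>v\<in>pvars f. lkp m v)"
  have lt: "lkp m v < N" if "m \<in> Poly_Mapping.keys f" "v \<in> pvars f" for m v
  proof -
    have "lkp m v \<le> (\<Sum>v\<in>pvars f. lkp m v)" using that pv by (intro member_le_sum) auto
    also have "\<dots> \<le> (\<Sum>m\<in>Poly_Mapping.keys f. \<Sum>v\<in>pvars f. lkp m v)"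
      using that by (intro member_le_sum[of m _ "\<lambda>m. \<Sum>v\<in>pvars f. lkp m v"]) auto
    finally show ?thesis by (simp add: N_def)
  qed
  obtain wt :: "nat \<times> int \<Rightarrow> nat" where wt: "\<And>a b. (\<forall>v\<in>pvars f. a v < N \<and> b v < N) \<Longrightarrow>
    (\<Sum>v\<in>pvars f. wt v * a v) = (\<Sum>v\<in>pvars f. wt v * b v) \<Longrightarrow> (\<forall>v\<in>pvars f. a v = b v)"
    using separating_weights[OF pv, of N] by blast
  define W where "W m = (\<Sum>v\<in>pvars f. wt v * lkp m v)" for m
  have keys_m: "Poly_Mapping.keys m \<subseteq> pvars f" if "m \<in> Poly_Mapping.keys f" for m
    using that by (auto simp: pvars_def)
  have inj: "m = m'" if m: "m \<in> Poly_Mapping.keys f" "m' \<in> Poly_Mapping.keys f" "W m = W m'" for m m'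
  proof (rule poly_mapping_eqI)
    fix v
    have "\<forall>v\<in>pvars f. lkp m v = lkp m' v"
      by (rule wt) (use m lt in \<open>auto simp: W_def\<close>)
    moreover have "lkp p v = 0" if "v \<notin> pvars f" "p \<in> Poly_Mapping.keys f" for p
    proof (rule ccontr)
      assume "lkp p v \<noteq> 0"
      then have "v \<in> Poly_Mapping.keys p" by (simp add: in_keys_iff)
      then show False using keys_m[OF that(2)] that(1) by blast
    qed
    ultimately show "lkp m v = lkp m' v" using m(1,2) by (cases "v \<in> pvars f") auto
  qed
  let ?X = "\<lambda>v. monom (1::'k) (wt v)"
  have mono: "mono_ev ?X m = monom 1 (W m)" if "m \<in> Poly_Mapping.keys f" for m
  proof -
    have "(\<Prod>v\<in>S. ?X v ^ lkp m v) = monom 1 (\<Sum>v\<in>S. wt v * lkp m v)" if "finite S" for S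
      using that by (induction S) (simp_all add: monom_power mult_monom mult.commute one_pCons monom_0)
    then show ?thesis using keys_m[OF that] pv by (simp add: mono_ev_superset[of "pvars f"] W_def)
  qed
  obtain m0 where m0: "m0 \<in> Poly_Mapping.keys f"
    using assms poly_mapping_eqI[of f 0] by (auto simp: in_keys_iff)
  have "coeff (pev ?X f) (W m0) = (\<Sum>m\<in>Poly_Mapping.keys f. if m = m0 then lkp f m else 0)"
    unfolding pev_def coeff_sum
    by (intro sum.cong) (use inj m0 in \<open>auto simp: mono coeff_monom_mult smult_monom\<close>)
  also have "\<dots> = lkp f m0" using m0 by simp
  finally have "pev ?X f \<noteq> 0" using m0 by (auto simp: in_keys_iff)
  then obtain s where "poly (pev ?X f) s \<noteq> 0" using poly_all_0_iff_0 by blast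
  then show ?thesis unfolding poly_pev by blast
qed

section \<open>Partial derivatives and the Lie-Poisson bracket\<close>

lemma pdiff_add: "pdiff v (f + g) = pdiff v f + pdiff v g"
  unfolding pdiff_def
  by (rule setsum_keys_plus_distrib[where f = "\<lambda>mon a. Poly_Mapping.single (mon - Poly_Mapping.single v 1) (of_nat (lkp mon v) * a)"])
    (simp_all add: distrib_left single_add)

lemma pdiff_single:
  "pdiff v (Poly_Mapping.single m a) = Poly_Mapping.single (m - Poly_Mapping.single v 1) (of_nat (lkp m v) * a)"
  by (simp add: pdiff_def)

lemma pdiff_0 [simp]: "pdiff v 0 = 0"
  by (simp add: pdiff_def)

lemma pdiff_mult: "pdiff v (f * g) = pdiff v f * g + f * pdiff v g"
proof (induction f rule: poly_mapping_single_induct)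
  case (single m a)
  show ?case
  proof (induction g rule: poly_mapping_single_induct)
    case (single m' b)
    let ?e = "Poly_Mapping.single v (1::nat)"
    \<comment> \<open>Exponents are subtracted with truncation, so this shift requires
      \<open>v\<close> to occur in \<open>m\<close>. When it does not, the coefficient
      \<open>lkp m v\<close> in front is zero.\<close>
    have sub: "m - ?e + m' = m + m' - ?e" if "lkp m v \<noteq> 0" for m m' :: "nat \<times> int \<Rightarrow>\<^sub>0 nat"
    proof (rule poly_mapping_eqI)
      fix u
      show "lkp (m - ?e + m') u = lkp (m + m' - ?e) u"
        using that by (cases "u = v") (auto simp: lookup_add lookup_minus lookup_single when_def)
    qed
    have 1: "Poly_Mapping.single (m - ?e) (of_nat (lkp m v) * a) * Poly_Mapping.single m' b
      = Poly_Mapping.single (m + m' - ?e) (of_nat (lkp m v) * (a * b))"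
      by (cases "lkp m v = 0") (simp_all add: mult_single sub[simplified] mult.assoc)
    have 2: "Poly_Mapping.single m a * Poly_Mapping.single (m' - ?e) (of_nat (lkp m' v) * b)
      = Poly_Mapping.single (m + m' - ?e) (of_nat (lkp m' v) * (a * b))"
      by (cases "lkp m' v = 0")
        (simp_all add: mult_single add.commute[of m] sub[simplified] mult.left_commute)
    show ?case
      unfolding mult_single[of m a m' b] pdiff_single 1 2 single_add[symmetric]
      by (simp add: lookup_add distrib_right)
  qed (simp_all add: pdiff_add algebra_simps)
qed (simp_all add: pdiff_add algebra_simps)

lemma pdiff_const [simp]: "pdiff v (const a) = 0"
  by (simp add: const_def pdiff_single)

lemma pdiff_sum: "pdiff v (\<Sum>i\<in>S. f i) = (\<Sum>i\<in>S. pdiff v (f i))"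
  by (induction S rule: infinite_finite_induct) (auto simp: pdiff_add)

lemma pdiff_var: "pdiff v (var u) = (if u = v then 1 else 0)"
  by (auto simp: var_def pdiff_single lookup_single when_def)

lemma const_0 [simp]: "const 0 = 0"
  by (simp add: const_def)

lemma pdiff_linp [simp]: "pdiff v (linp x) = const (lkp x v)"
proof -
  have "pdiff v (linp x) = (\<Sum>u\<in>Poly_Mapping.keys x. if u = v then const (lkp x v) else 0)"
    unfolding linp_def pdiff_sum by (intro sum.cong) (auto simp: pdiff_mult pdiff_var)
  also have "\<dots> = const (lkp x v)" by (auto simp: in_keys_iff)
  finally show ?thesis .
qed

lemma pdiff_not_pvars: "v \<notin> pvars f \<Longrightarrow> pdiff v f = 0"
  unfolding pdiff_def by (rule sum.neutral) (auto simp: pvars_def in_keys_iff)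

lemma finite_pvars [simp]: "finite (pvars f)"
  by (simp add: pvars_def)

text \<open>Derivatives vanish outside \<open>pvars\<close>, so the index sets can be enlarged. This
  gives brackets of different polynomials a common range of summation.\<close>

lemma pbr_superset:
  assumes "finite U" "pvars f \<subseteq> U" "finite V" "pvars g \<subseteq> V"
  shows "pbr n c f g = (\<Sum>u\<in>U. \<Sum>v\<in>V. pdiff u f * pdiff v g * loopbr_basis n c u v)"
proof -
  have "pbr n c f g = (\<Sum>u\<in>pvars f. \<Sum>v\<in>V. pdiff u f * pdiff v g * loopbr_basis n c u v)"
    unfolding pbr_def
    by (intro sum.cong[OF refl] sum.mono_neutral_left) (use assms in \<open>auto simp: pdiff_not_pvars\<close>)
  also have "\<dots> = (\<Sum>u\<in>U. \<Sum>v\<in>V. pdiff u f * pdiff v g * loopbr_basis n c u v)"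
    by (intro sum.mono_neutral_left) (use assms in \<open>auto simp: pdiff_not_pvars\<close>)
  finally show ?thesis .
qed

lemma pbr_const_right: "pbr n c f (const a) = 0"
  by (simp add: pbr_def)

lemma pbr_add_right: "pbr n c f (g + h) = pbr n c f g + pbr n c f h"
proof -
  let ?V = "pvars (g + h) \<union> pvars g \<union> pvars h"
  show ?thesis
    by (subst (1 2 3) pbr_superset[of "pvars f" _ ?V])
      (auto simp: pdiff_add algebra_simps sum.distrib)
qed

lemma pbr_mult_right: "pbr n c f (g * h) = pbr n c f g * h + pbr n c f h * g"
proof -
  let ?V = "pvars (g * h) \<union> pvars g \<union> pvars h"
  show ?thesis
    by (subst (1 2 3) pbr_superset[of "pvars f" _ ?V])
      (auto simp: pdiff_mult algebra_simps sum.distrib sum_distrib_left)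
qed

lemma ev_pbr:
  "ev \<phi> (pbr n c f g) = (\<Sum>u\<in>pvars f. \<Sum>v\<in>pvars g. ev \<phi> (pdiff u f) * ev \<phi> (pdiff v g) *
     (\<Sum>l<n. c (fst u) (fst v) l * \<phi> (l, snd u + snd v)))"
  by (simp add: pbr_def loopbr_basis_def)

lemma salg_mono: "U \<subseteq> U' \<Longrightarrow> salg U \<subseteq> salg U'"
proof
  fix f assume "U \<subseteq> U'" "f \<in> salg U"
  from this(2,1) show "f \<in> salg U'" by induction (auto intro: salg.intros)
qed

text \<open>The derivative of a generator is a constant, and the Leibniz rule does the rest. Hence
  points that agree on \<open>U\<close> also give elements of \<open>salg U\<close> the same
  differential.\<close>

lemma pdiff_salg: "f \<in> salg U \<Longrightarrow> pdiff v f \<in> salg U"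
  by (induction rule: salg.induct)
    (auto simp: pdiff_add pdiff_mult intro: salg.intros, metis const_0 salg.const)

lemma idealgen_mult_right: "f \<in> idealgen U (salg W) \<Longrightarrow> g \<in> salg W \<Longrightarrow> f * g \<in> idealgen U (salg W)"
  by (induction rule: idealgen.induct)
    (auto simp: distrib_right mult.assoc intro: idealgen.intros salg.mult)

lemma ev_cong_salg:
  assumes "\<And>x. x \<in> U \<Longrightarrow> ev \<phi> (linp x) = ev \<psi> (linp x)"
  shows "f \<in> salg U \<Longrightarrow> ev \<phi> f = ev \<psi> f"
  by (induction rule: salg.induct) (use assms in auto)

lemma ev_idealgen_0:
  assumes "\<And>x. x \<in> U \<Longrightarrow> ev \<phi> (linp x) = 0"
  shows "f \<in> idealgen U R \<Longrightarrow> ev \<phi> f = 0"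
  by (induction rule: idealgen.induct) (use assms in auto)

section \<open>The twisted loop algebra\<close>

text \<open>\<open>tact a\<close> is the action of \<open>\<Theta>\<close> on \<open>q t\<^sup>a\<close>.\<close>

definition tact :: "nat \<Rightarrow> (nat \<Rightarrow> nat \<Rightarrow> 'k::field) \<Rightarrow> 'k \<Rightarrow> int \<Rightarrow> (nat \<Rightarrow> 'k) \<Rightarrow> (nat \<Rightarrow> 'k)" where
  "tact n th z a x = vscale (z powi a) (matapp n th x)"

text \<open>A point is a linear functional on the loop algebra; its slice is the restriction to
  \<open>q t^a\<close>, viewed as a form on \<open>q\<close>.\<close>

definition slice :: "(nat \<times> int \<Rightarrow> 'k) \<Rightarrow> int \<Rightarrow> nat \<Rightarrow> 'k" where
  "slice \<phi> a l = \<phi> (l, a)"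

text \<open>The \<open>t^a\<close> component of the differential of \<open>f\<close> at the point,
  viewed as a vector of \<open>q\<close>.\<close>

definition dvec :: "'k::field spoly \<Rightarrow> (nat \<times> int \<Rightarrow> 'k) \<Rightarrow> int \<Rightarrow> nat \<Rightarrow> 'k" where
  "dvec f \<phi> a i = ev \<phi> (pdiff (i, a) f)"

lemma tact_qvec: "tact n th z a x \<in> qvec n"
  by (simp add: tact_def qvec_def vscale_def matapp_def)

lemma matapp_add: "matapp n th (x + y) = matapp n th x + matapp n th y"
  by (auto simp: matapp_def fun_eq_iff sum.distrib distrib_left)

lemma matapp_vscale: "matapp n th (vscale a x) = vscale a (matapp n th x)"
  by (auto simp: matapp_def fun_eq_iff vscale_def sum_distrib_left mult_ac)

lemma tact_add: "tact n th z a (x + y) = tact n th z a x + tact n th z a y"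
  by (simp add: tact_def matapp_add qv.scale_right_distrib)

lemma tact_vscale: "tact n th z a (vscale b x) = vscale b (tact n th z a x)"
  by (simp add: tact_def matapp_vscale mult.commute)

lemma tact_0: "tact n th z a 0 = 0"
  by (auto simp: tact_def matapp_def vscale_def fun_eq_iff)

lemma tact_sum: "tact n th z a (\<Sum>i\<in>S. f i) = (\<Sum>i\<in>S. tact n th z a (f i))"
  by (induction S rule: infinite_finite_induct) (simp_all add: tact_0 tact_add del: zero_fun_apply plus_fun_apply)

lemma pairing_add: "pairing n xi (x + y) = pairing n xi x + pairing n xi y"
  by (simp add: pairing_def sum.distrib distrib_left)

lemma pairing_0: "pairing n xi 0 = 0"
  by (simp add: pairing_def)

lemma qbr_vscale: "qbr n c (vscale a x) (vscale b y) = vscale (a * b) (qbr n c x y)"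
  by (auto simp: qbr_def fun_eq_iff vscale_def sum_distrib_left mult_ac)

lemma qbr_qvec: "qbr n c x y \<in> qvec n"
  by (simp add: qbr_def qvec_def)

lemma primitive_root_nonzero: "primitive_root m z \<Longrightarrow> 0 < m \<Longrightarrow> z \<noteq> 0"
  by (auto simp: primitive_root_def power_0_left)

lemma tact_qbr:
  assumes "is_aut_order n c th m" "z \<noteq> 0" "x \<in> qvec n" "y \<in> qvec n"
  shows "tact n th z (a + b) (qbr n c x y) = qbr n c (tact n th z a x) (tact n th z b y)"
  using assms by (simp add: tact_def qbr_vscale power_int_add is_aut_order_def)

lemma tact_funpow: "(tact n th z a ^^ i) x = vscale ((z powi a) ^ i) ((matapp n th ^^ i) x)"
  by (induction i) (simp_all add: tact_def matapp_vscale mult.commute)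

lemma power_int_pow_swap: "(z powi a) ^ i = (z ^ i) powi a" for z :: "'k::field"
  by (cases a rule: int_cases2) (simp_all add: power_int_def power_mult[symmetric] power_inverse mult.commute)

lemma tact_order:
  assumes "is_aut_order n c th m" "primitive_root m z" "x \<in> qvec n"
  shows "(tact n th z a ^^ m) x = x"
  using assms by (simp add: tact_funpow power_int_pow_swap is_aut_order_def primitive_root_def)

text \<open>Applying the action shifts the orbit cyclically: the new last term is the
  \<open>m\<close>-th iterate, which is \<open>x\<close> again.\<close>

lemma tact_orbit_sum_swap:
  assumes "is_aut_order n c th m" "primitive_root m z" "x \<in> qvec n"
  shows "(\<Sum>i<m. (tact n th z a ^^ i) (tact n th z a x)) = (\<Sum>i<m. (tact n th z a ^^ i) x)"
proof -
  let ?T = "tact n th z a"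
  have "(\<Sum>i<m. (?T ^^ i) (?T x)) = (\<Sum>i<m. (?T ^^ Suc i) x)" by (simp add: funpow_swap1)
  also have "\<dots> = (\<Sum>i<Suc m. (?T ^^ i) x) - x"
    by (simp only: sum.lessThan_Suc_shift) simp
  also have "\<dots> = (\<Sum>i<m. (?T ^^ i) x)"
    by (simp only: sum.lessThan_Suc tact_order[OF assms]) simp
  finally show ?thesis .
qed

lemma tact_orbit_sum:
  assumes "is_aut_order n c th m" "primitive_root m z" "x \<in> qvec n"
  shows "tact n th z a (\<Sum>i<m. (tact n th z a ^^ i) x) = (\<Sum>i<m. (tact n th z a ^^ i) x)"
proof -
  let ?T = "tact n th z a"
  have "?T (\<Sum>i<m. (?T ^^ i) x) = (\<Sum>i<m. (?T ^^ i) (?T x))"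
    by (simp add: tact_sum funpow_swap1)
  then show ?thesis by (simp add: tact_orbit_sum_swap[OF assms])
qed

text \<open>The orbit sum of \<open>x\<close> is fixed and \<open>L\<close> takes the value
  \<open>m * L x\<close> on it; characteristic 0 allows division by \<open>m\<close>. Invariance of
  elements of \<open>Zcent\<close> is only tested on twisted elements, and this extends its
  consequences to all of \<open>q\<close>.\<close>

lemma vanishes_if_vanishes_on_fixed:
  fixes L :: "(nat \<Rightarrow> 'k::field_char_0) \<Rightarrow> 'k"
  assumes aut: "is_aut_order n c th m" "primitive_root m z"
    and add: "\<And>x y. L (x + y) = L x + L y"
    and inv: "\<And>x. x \<in> qvec n \<Longrightarrow> L (tact n th z a x) = L x"
    and vanish: "\<And>x. x \<in> qvec n \<Longrightarrow> tact n th z a x = x \<Longrightarrow> L x = 0"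
    and x: "x \<in> qvec n"
  shows "L x = 0"
proof -
  let ?T = "tact n th z a"
  have L0: "L 0 = 0" using add[of 0 0] by simp
  have Lsum: "L (\<Sum>i\<in>S. f i) = (\<Sum>i\<in>S. L (f i))" for S and f :: "nat \<Rightarrow> nat \<Rightarrow> 'k"
    by (induction S rule: infinite_finite_induct) (simp_all add: L0 add del: zero_fun_apply plus_fun_apply)
  have mem: "(?T ^^ i) x \<in> qvec n" for i
    by (cases i) (simp_all add: x tact_qvec)
  have Lpow: "L ((?T ^^ i) x) = L x" for i
    by (induction i) (simp_all add: inv mem)
  have "(\<Sum>i<m. (?T ^^ i) x) \<in> qvec n"
    by (subst tact_orbit_sum[OF aut x, symmetric]) (rule tact_qvec)
  from vanish[OF this tact_orbit_sum[OF aut x]] have "of_nat m * L x = 0"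
    by (simp add: Lsum Lpow)
  then show ?thesis using aut(1) by (simp add: is_aut_order_def)
qed

section \<open>Invariant points and averaging over the cyclic group\<close>

lemma pairing_sum: "pairing n xi (\<Sum>i\<in>S. f i) = (\<Sum>i\<in>S. pairing n xi (f i))"
  by (induction S rule: infinite_finite_induct) 
    (simp_all add: pairing_add pairing_0 del: zero_fun_apply plus_fun_apply)

lemma pairing_vscale: "pairing n xi (vscale a x) = a * pairing n xi x"
  by (simp add: pairing_def vscale_def sum_distrib_left mult_ac)

text \<open>Decompose \<open>m x\<close> into eigenvectors of the automorphism. The form
  \<open>rho\<close> sees only the component \<open>y 0 x\<close>, which does not change when the
  automorphism is applied to \<open>x\<close>.\<close>

lemma dual0_invariant:
  fixes rho :: "nat \<Rightarrow> 'k::field_char_0"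
  assumes aut: "is_aut_order n c th m" "primitive_root m z"
    and rho: "rho \<in> dual0 n th z m" and x: "x \<in> qvec n"
  shows "pairing n rho (tact n th z 0 x) = pairing n rho x"
proof -
  have m: "0 < m" using aut(1) by (simp add: is_aut_order_def)
  have z0: "z \<noteq> 0" using primitive_root_nonzero[OF aut(2) m] .
  \<comment> \<open>Up to the factor \<open>m\<close>, this is the projection onto the eigenspace
    for \<open>z ^ j\<close>; the twist by \<open>z powi (- int j)\<close> turns that eigenspace
    into fixed vectors.\<close>
  define y where "y j x = (\<Sum>i<m. (tact n th z (- int j) ^^ i) x)" for j :: nat and x
  have mem: "y j x \<in> qvec n" if "x \<in> qvec n" for j x
    unfolding y_def by (subst tact_orbit_sum[OF aut that, symmetric]) (rule tact_qvec)
  have "pairing n rho (y j x) = 0" if "x \<in> qvec n" "1 \<le> j" "j < m" for j x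
  proof -
    have "vscale (z powi (- int j)) (matapp n th (y j x)) = y j x"
      using tact_orbit_sum[OF aut that(1), of "- int j"] by (simp add: tact_def y_def)
    then have "vscale (z ^ j) (y j x) = vscale (z ^ j) (vscale (z powi (- int j)) (matapp n th (y j x)))"
      by simp
    also have "\<dots> = matapp n th (y j x)" using z0 by (simp add: power_int_minus)
    finally have "y j x \<in> eigsp n th z j" using mem[OF that(1)] by (simp add: eigsp_def)
    then show ?thesis using rho that(2,3) by (simp add: dual0_def)
  qed
  then have "pairing n rho (\<Sum>j<m. y j x) = (\<Sum>j<m. if j = 0 then pairing n rho (y 0 x) else 0)"
    if "x \<in> qvec n" for x
    unfolding pairing_sum by (intro sum.cong) (use that in auto)
  then have only0: "pairing n rho (\<Sum>j<m. y j x) = pairing n rho (y 0 x)" if "x \<in> qvec n" for x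
    using that m by simp
  have total: "(\<Sum>j<m. y j x) = vscale (of_nat m) x" if "x \<in> qvec n" for x
  proof -
    \<comment> \<open>Orthogonality of characters: for \<open>i\<close> nonzero the sum is
      geometric, with ratio an \<open>m\<close>-th root of unity different from 1.\<close>
    have char: "(\<Sum>j<m. (z powi (- int j)) ^ i) = (if i = 0 then of_nat m else 0)" if "i < m" for i
    proof (cases "i = 0")
      case False
      define w where "w = inverse (z ^ i)"
      have "z ^ i \<noteq> 1" using False that aut(2) by (simp add: primitive_root_def)
      then have w1: "w \<noteq> 1" using inverse_eq_1_iff[of "z ^ i"] by (simp add: w_def)
      have "w ^ m = inverse ((z ^ m) ^ i)"
        by (simp add: w_def power_inverse power_mult[symmetric] mult.commute)
      also have "\<dots> = 1" using aut(2) by (simp add: primitive_root_def)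
      finally have "(w - 1) * (\<Sum>j<m. w ^ j) = 0" by (simp add: power_diff_1_eq[symmetric])
      then have "(\<Sum>j<m. w ^ j) = 0" using w1 by simp
      moreover have "(z powi (- int j)) ^ i = w ^ j" for j
        by (simp add: w_def power_int_minus power_inverse power_mult[symmetric] mult.commute)
      ultimately show ?thesis using False by simp
    qed simp
    have "(\<Sum>j<m. y j x) = (\<Sum>i<m. \<Sum>j<m. vscale ((z powi (- int j)) ^ i) ((matapp n th ^^ i) x))"
      unfolding y_def tact_funpow by (rule sum.swap)
    also have "\<dots> = (\<Sum>i<m. vscale (if i = 0 then of_nat m else 0) ((matapp n th ^^ i) x))"
      by (intro sum.cong) (auto simp: qv.scale_sum_left[symmetric] char)
    also have "\<dots> = (\<Sum>i<m. if i = 0 then vscale (of_nat m) x else 0)"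
      by (intro sum.cong) auto
    finally show ?thesis using m by simp
  qed
  have y0: "y 0 (tact n th z 0 x) = y 0 x"
    using tact_orbit_sum_swap[OF aut x, of 0] by (simp add: y_def)
  have "of_nat m * pairing n rho (tact n th z 0 x) = of_nat m * pairing n rho x"
    using only0[OF x] only0[OF tact_qvec] total[OF x] total[OF tact_qvec] y0 by (simp add: pairing_vscale)
  then show ?thesis using m by simp
qed

text \<open>A functional on the twisted loop algebra is encoded as an invariant functional on the
  whole loop algebra. Vanishing in negative degrees makes the ideal generated by
  \<open>twisted_neg\<close> evaluate to zero.\<close>

definition invariant_point :: "nat \<Rightarrow> (nat \<Rightarrow> nat \<Rightarrow> 'k::field) \<Rightarrow> 'k \<Rightarrow> (nat \<times> int \<Rightarrow> 'k) \<Rightarrow> bool" where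
  "invariant_point n th z \<phi> \<longleftrightarrow>
    (\<forall>a. \<forall>x\<in>qvec n. pairing n (slice \<phi> a) (tact n th z a x) = pairing n (slice \<phi> a) x) \<and>
    (\<forall>a<0. \<forall>l. \<phi> (l, a) = 0)"

definition transp_tact :: "nat \<Rightarrow> (nat \<Rightarrow> nat \<Rightarrow> 'k::field) \<Rightarrow> 'k \<Rightarrow> int \<Rightarrow> (nat \<Rightarrow> 'k) \<Rightarrow> (nat \<Rightarrow> 'k)" where
  "transp_tact n th z a xi j = (\<Sum>i<n. xi i * (z powi a * th i j))"

lemma pairing_transp_tact: "pairing n (transp_tact n th z a xi) x = pairing n xi (tact n th z a x)"
proof -
  have "pairing n (transp_tact n th z a xi) x = (\<Sum>j<n. \<Sum>i<n. xi i * (z powi a * (th i j * x j)))"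
    by (simp add: pairing_def transp_tact_def sum_distrib_right mult.assoc)
  also have "\<dots> = (\<Sum>i<n. \<Sum>j<n. xi i * (z powi a * (th i j * x j)))" by (rule sum.swap)
  also have "\<dots> = pairing n xi (tact n th z a x)"
    by (simp add: pairing_def tact_def vscale_def matapp_def sum_distrib_left)
  finally show ?thesis .
qed

lemma pairing_transp_tact_funpow:
  "pairing n ((transp_tact n th z a ^^ i) xi) x = pairing n xi ((tact n th z a ^^ i) x)"
proof (induction i arbitrary: x)
  case (Suc i)
  have "pairing n ((transp_tact n th z a ^^ Suc i) xi) x
      = pairing n ((transp_tact n th z a ^^ i) xi) (tact n th z a x)"
    by (simp add: pairing_transp_tact)
  then show ?case by (simp add: Suc.IH funpow_swap1)
qed simp

text \<open>The projection of a linear form onto the invariant forms. It leaves the values on fixed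
  vectors unchanged.\<close>

definition average :: "nat \<Rightarrow> (nat \<Rightarrow> nat \<Rightarrow> 'k::field) \<Rightarrow> 'k \<Rightarrow> nat \<Rightarrow> int \<Rightarrow> (nat \<Rightarrow> 'k) \<Rightarrow> (nat \<Rightarrow> 'k)" where
  "average n th z m a xi l = inverse (of_nat m) * (\<Sum>i<m. (transp_tact n th z a ^^ i) xi l)"

lemma pairing_average:
  "pairing n (average n th z m a xi) x
    = inverse (of_nat m) * pairing n xi (\<Sum>i<m. (tact n th z a ^^ i) x)"
proof -
  have "pairing n (average n th z m a xi) x
      = inverse (of_nat m) * (\<Sum>l<n. \<Sum>i<m. (transp_tact n th z a ^^ i) xi l * x l)"
    by (simp add: pairing_def average_def sum_distrib_left sum_distrib_right mult.assoc)
  also have "(\<Sum>l<n. \<Sum>i<m. (transp_tact n th z a ^^ i) xi l * x l)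
      = (\<Sum>i<m. pairing n ((transp_tact n th z a ^^ i) xi) x)"
    unfolding pairing_def by (rule sum.swap)
  finally show ?thesis by (simp add: pairing_transp_tact_funpow pairing_sum)
qed

lemma average_invariant:
  assumes "is_aut_order n c th m" "primitive_root m z" "x \<in> qvec n"
  shows "pairing n (average n th z m a xi) (tact n th z a x) = pairing n (average n th z m a xi) x"
proof -
  have "(\<Sum>i<m. (tact n th z a ^^ i) (tact n th z a x)) = (\<Sum>i<m. (tact n th z a ^^ i) x)"
    using tact_orbit_sum_swap[OF assms] .
  then show ?thesis by (simp add: pairing_average)
qed

lemma average_on_fixed:
  fixes z :: "'k::field_char_0"
  assumes "0 < m" "tact n th z a x = x"
  shows "pairing n (average n th z m a xi) x = pairing n xi x"
proof -
  have "(tact n th z a ^^ i) x = x" for i by (induction i) (simp_all add: assms)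
  then show ?thesis using assms(1) by (simp add: pairing_average pairing_sum del: sum_constant) simp
qed

lemma loopvec_lookup:
  assumes "x \<in> loopvec n" "n \<le> i"
  shows "lkp x (i, a) = 0"
proof (rule ccontr)
  assume "lkp x (i, a) \<noteq> 0"
  then have "(i, a) \<in> Poly_Mapping.keys x" by (simp add: in_keys_iff)
  then have "i < n" using assms(1) unfolding loopvec_def by blast
  then show False using assms(2) by simp
qed

lemma twisted_plus_lookup:
  assumes "x \<in> twisted_plus n th z" "a < 0"
  shows "lkp x (i, a) = 0"
proof (rule ccontr)
  assume "lkp x (i, a) \<noteq> 0"
  then have "(i, a) \<in> Poly_Mapping.keys x" by (simp add: in_keys_iff)
  then have "0 \<le> a" using assms(1) unfolding twisted_plus_def by blast
  then show False using assms(2) by simp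
qed

text \<open>By the Leibniz rule the differential is a linear combination of the generators involved,
  so it inherits the linear conditions that define \<open>twisted_plus\<close>.\<close>

lemma dvec_salg_twisted_plus:
  assumes "f \<in> salg (twisted_plus n th z)"
  shows "tact n th z a (dvec f \<phi> a) = dvec f \<phi> a" "dvec f \<phi> a \<in> qvec n" "a < 0 \<Longrightarrow> dvec f \<phi> a = 0"
proof -
  have lincomb: "dvec (f * g) \<phi> a = vscale (ev \<phi> g) (dvec f \<phi> a) + vscale (ev \<phi> f) (dvec g \<phi> a)" for f g
    by (simp add: dvec_def fun_eq_iff pdiff_mult vscale_def mult.commute)
  have dadd: "dvec (f + g) \<phi> a = dvec f \<phi> a + dvec g \<phi> a" for f g
    by (simp add: dvec_def fun_eq_iff pdiff_add)
  have dconst: "dvec (const b) \<phi> a = 0" for b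
    by (simp add: dvec_def fun_eq_iff)
  have dlin: "dvec (linp x) \<phi> a = tcoef x a" for x
    by (simp add: dvec_def fun_eq_iff tcoef_def)
  show "tact n th z a (dvec f \<phi> a) = dvec f \<phi> a"
    using assms
  proof induction
    case (lin x)
    then show ?case by (simp add: dlin twisted_plus_def twisted_def tact_def)
  qed (simp_all add: lincomb dadd dconst tact_add tact_vscale tact_0 del: zero_fun_apply plus_fun_apply)
  show "dvec f \<phi> a \<in> qvec n"
    using assms
  proof induction
    case (lin x)
    then have "x \<in> loopvec n" by (simp add: twisted_plus_def twisted_def)
    then show ?case by (simp add: dlin tcoef_def qvec_def loopvec_lookup)
  qed (simp_all add: lincomb dadd dconst qvec_def vscale_def)
  show "dvec f \<phi> a = 0" if "a < 0"
    using assms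
  proof induction
    case (lin x)
    then show ?case using that by (simp add: dlin tcoef_def fun_eq_iff twisted_plus_lookup)
  qed (simp_all add: lincomb dadd dconst vscale_def fun_eq_iff)
qed

section \<open>The bracket at a point, degree by degree, and the use of invariance\<close>

lemma dvec_outside_pvars: "a \<notin> snd ` pvars f \<Longrightarrow> dvec f \<phi> a = 0"
proof
  fix i assume "a \<notin> snd ` pvars f"
  then have "(i, a) \<notin> pvars f" by force
  then show "dvec f \<phi> a i = 0 i" by (simp add: dvec_def pdiff_not_pvars)
qed

text \<open>The value of the bracket at a point is the point applied to the Lie bracket of the two
  differentials, here grouped by powers of \<open>t\<close>. The ranges \<open>S\<close> and
  \<open>T\<close> are left free so that both can be taken as one common interval.\<close>

lemma ev_pbr_slices:
  assumes S: "finite S" "\<And>a. dvec f \<phi> a \<in> qvec n" "\<And>a. a \<notin> S \<Longrightarrow> dvec f \<phi> a = 0"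
    and T: "finite T" "\<And>a. dvec g \<phi> a \<in> qvec n" "\<And>a. a \<notin> T \<Longrightarrow> dvec g \<phi> a = 0"
  shows "ev \<phi> (pbr n c f g)
    = (\<Sum>a\<in>S. \<Sum>b\<in>T. pairing n (slice \<phi> (a + b)) (qbr n c (dvec f \<phi> a) (dvec g \<phi> b)))"
proof -
  have box: "(\<Sum>u\<in>pvars h. ev \<phi> (pdiff u h) * k u) = (\<Sum>a\<in>R. \<Sum>i<n. dvec h \<phi> a i * k (i, a))"
    if R: "finite R" "\<And>a. dvec h \<phi> a \<in> qvec n" "\<And>a. a \<notin> R \<Longrightarrow> dvec h \<phi> a = 0" for h R k
  proof -
    have "dvec h \<phi> a i = 0" if "\<not> (i < n \<and> a \<in> R)" for i a
    proof (cases "a \<in> R")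
      case True
      then show ?thesis using that R(2)[of a] by (simp add: qvec_def)
    qed (simp add: R(3))
    then have out: "ev \<phi> (pdiff u h) = 0" if "u \<notin> {..<n} \<times> R" for u
      using that by (cases u) (auto simp: dvec_def)
    have "(\<Sum>u\<in>pvars h. ev \<phi> (pdiff u h) * k u) = (\<Sum>u\<in>{..<n} \<times> R. ev \<phi> (pdiff u h) * k u)"
      by (rule sum.mono_neutral_cong) (use R(1) out in \<open>auto simp: pdiff_not_pvars\<close>)
    also have "\<dots> = (\<Sum>i<n. \<Sum>a\<in>R. dvec h \<phi> a i * k (i, a))"
      by (simp add: sum.cartesian_product dvec_def case_prod_beta)
    also have "\<dots> = (\<Sum>a\<in>R. \<Sum>i<n. dvec h \<phi> a i * k (i, a))" by (rule sum.swap)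
    finally show ?thesis .
  qed
  have "ev \<phi> (pbr n c f g) = (\<Sum>u\<in>pvars f. ev \<phi> (pdiff u f) * (\<Sum>v\<in>pvars g. ev \<phi> (pdiff v g) *
     (\<Sum>l<n. c (fst u) (fst v) l * \<phi> (l, snd u + snd v))))"
    by (simp add: ev_pbr sum_distrib_left mult.assoc)
  also have "\<dots> = (\<Sum>a\<in>S. \<Sum>i<n. dvec f \<phi> a i * (\<Sum>b\<in>T. \<Sum>j<n. dvec g \<phi> b j *
     (\<Sum>l<n. c i j l * \<phi> (l, a + b))))"
    by (simp add: box[OF S] box[OF T])
  also have "\<dots> = (\<Sum>a\<in>S. \<Sum>b\<in>T. \<Sum>i<n. dvec f \<phi> a i * (\<Sum>j<n. dvec g \<phi> b j *
     (\<Sum>l<n. c i j l * \<phi> (l, a + b))))"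
    by (intro sum.cong refl, subst sum.swap) (simp add: sum_distrib_left)
  also have "\<dots> = (\<Sum>a\<in>S. \<Sum>b\<in>T. pairing n (slice \<phi> (a + b)) (qbr n c (dvec f \<phi> a) (dvec g \<phi> b)))"
    by (simp add: pairing_qbr dotp_def mvec_def coadj_mat_def slice_def mult.commute)
  finally show ?thesis .
qed

definition homog :: "nat \<Rightarrow> (nat \<Rightarrow> 'k::field) \<Rightarrow> int \<Rightarrow> 'k loopel" where
  "homog n x k = (\<Sum>i<n. Poly_Mapping.single (i, k) (x i))"

lemma tcoef_homog: "x \<in> qvec n \<Longrightarrow> tcoef (homog n x k) a = (if a = k then x else 0)"
proof
  fix i assume x: "x \<in> qvec n"
  have "tcoef (homog n x k) a i = (\<Sum>j<n. if i = j then (if a = k then x j else 0) else 0)"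
    unfolding tcoef_def homog_def lookup_sum
    by (intro sum.cong) (auto simp: lookup_single when_def)
  then show "tcoef (homog n x k) a i = (if a = k then x else 0) i"
    using x by (auto simp: qvec_def)
qed

lemma homog_twisted_nonpos:
  assumes "x \<in> qvec n" "tact n th z k x = x" "k \<le> 0"
  shows "homog n x k \<in> twisted_nonpos n th z"
proof -
  have keys: "i < n \<and> a = k" if "(i, a) \<in> Poly_Mapping.keys (homog n x k)" for i a
  proof -
    have "tcoef (homog n x k) a i \<noteq> 0" using that by (simp add: tcoef_def in_keys_iff)
    then have "a = k" "x i \<noteq> 0" using assms(1) by (auto simp: tcoef_homog split: if_splits)
    then show ?thesis using assms(1) by (auto simp: qvec_def not_less[symmetric])
  qed
  have "vscale (z powi a) (matapp n th (tcoef (homog n x k) a)) = tcoef (homog n x k) a" for a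
    using assms(2) tact_0[of n th z a] by (simp add: tcoef_homog[OF assms(1)] tact_def)
  then show ?thesis using keys assms(3)
    by (auto simp: twisted_nonpos_def twisted_def loopvec_def)
qed

lemma dvec_linp: "dvec (linp x) \<phi> a = tcoef x a"
  by (simp add: dvec_def tcoef_def fun_eq_iff)

lemma ev_idealgen_invariant_point:
  assumes "invariant_point n th z \<phi>" "f \<in> idealgen (twisted_neg n th z) R"
  shows "ev \<phi> f = 0"
proof (rule ev_idealgen_0[OF _ assms(2)])
  fix x assume "x \<in> twisted_neg n th z"
  then show "ev \<phi> (linp x) = 0"
    using assms(1) unfolding ev_linp
    by (intro sum.neutral) (auto simp: twisted_neg_def invariant_point_def)
qed

text \<open>Evaluating the defining condition of \<open>Zcent\<close> for \<open>x t^(-k)\<close> at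
  an invariant point gives the hypotheses of \<open>invariant_brackets_vanish\<close> for fixed
  \<open>x\<close>, and averaging gives them for every \<open>x\<close>.\<close>

lemma pbr_Zcent_vanishes:
  fixes c :: "nat \<Rightarrow> nat \<Rightarrow> nat \<Rightarrow> 'k::field_char_0"
  assumes lie: "is_lie_algebra n c" and aut: "is_aut_order n c th m" "primitive_root m z"
    and J: "\<And>eta x. inj_mat n (add_diag J (coadj_mat n c eta)) \<Longrightarrow>
      \<exists>v. (\<forall>i<n. mvec n (coadj_mat n c eta) v i = 0) \<and> (\<forall>j<n. j \<in> J \<longrightarrow> v j = x j)"
    and \<phi>: "invariant_point n th z \<phi>"
    and J0: "inj_mat n (add_diag J (coadj_mat n c (slice \<phi> 0)))"
    and f: "f \<in> Zcent n c th z" and g: "g \<in> Zcent n c th z"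
  shows "ev \<phi> (pbr n c f g) = 0"
proof -
  have z0: "z \<noteq> 0" using primitive_root_nonzero[OF aut(2)] aut(1) by (simp add: is_aut_order_def)
  \<comment> \<open>A common bound for the degrees in \<open>f\<close> and \<open>g\<close>;
    inserting 0 keeps the maximum defined and nonnegative.\<close>
  define N where "N = nat (Max (insert 0 (snd ` (pvars f \<union> pvars g))))"
  let ?S = "{0..int N}"
  have salg: "h \<in> salg (twisted_plus n th z)" if "h \<in> {f, g}" for h
    using that f g by (auto simp: Zcent_def)
  have out: "dvec h \<phi> a = 0" if "h \<in> {f, g}" "a \<notin> ?S" for h a
  proof (cases "a < 0")
    case True
    then show ?thesis by (rule dvec_salg_twisted_plus(3)[OF salg[OF that(1)]])
  next
    case False
    have "b \<le> int N" if "b \<in> snd ` (pvars f \<union> pvars g)" for b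
    proof -
      have "b \<le> Max (insert 0 (snd ` (pvars f \<union> pvars g)))" using that by (intro Max_ge) auto
      then show ?thesis by (simp add: N_def)
    qed
    then have "a \<notin> snd ` pvars h" using False that by fastforce
    then show ?thesis by (rule dvec_outside_pvars)
  qed
  have mem: "dvec h \<phi> a \<in> qvec n" if "h \<in> {f, g}" for h a
    by (rule dvec_salg_twisted_plus(2)[OF salg[OF that]])
  have fixpt: "tact n th z a (dvec h \<phi> a) = dvec h \<phi> a" if "h \<in> {f, g}" for h a
    by (rule dvec_salg_twisted_plus(1)[OF salg[OF that]])
  have int_sum: "(\<Sum>a\<in>?S. k a) = (\<Sum>a\<le>N. k (int a))" for k :: "int \<Rightarrow> 'k"
    by (rule sum.reindex_bij_witness[of _ int nat]) auto
  have inv: "(\<Sum>a=k..N. pairing n (slice \<phi> (int (a - k))) (qbr n c x (dvec h \<phi> (int a)))) = 0"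
    if h: "h \<in> {f, g}" and k: "k \<le> N" and x: "x \<in> qvec n" for h k x
  proof -
    define L where "L x = (\<Sum>a=k..N. pairing n (slice \<phi> (int (a - k))) (qbr n c x (dvec h \<phi> (int a))))" for x
    have "L x = 0"
    proof (rule vanishes_if_vanishes_on_fixed[OF aut, of L "- int k"])
      show "L (x + y) = L x + L y" for x y
        by (simp add: L_def qbr_add_left pairing_add sum.distrib)
      \<comment> \<open>The differential in degree \<open>a\<close> is fixed, so acting on
        \<open>x\<close> in degree \<open>-k\<close> amounts to acting on the bracket in degree
        \<open>a - k\<close>, where the slice of the point is invariant.\<close>
      show "L (tact n th z (- int k) x) = L x" if x: "x \<in> qvec n" for x
        unfolding L_def
      proof (intro sum.cong refl)
        fix a assume a: "a \<in> {k..N}"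
        let ?y = "dvec h \<phi> (int a)"
        have "qbr n c (tact n th z (- int k) x) ?y = qbr n c (tact n th z (- int k) x) (tact n th z (int a) ?y)"
          by (simp add: fixpt[OF h])
        also have "\<dots> = tact n th z (int (a - k)) (qbr n c x ?y)"
          using a tact_qbr[OF aut(1) z0 x mem[OF h, of "int a"], of "- int k" "int a"] by (simp add: of_nat_diff)
        finally show "pairing n (slice \<phi> (int (a - k))) (qbr n c (tact n th z (- int k) x) ?y)
            = pairing n (slice \<phi> (int (a - k))) (qbr n c x ?y)"
          using \<phi> qbr_qvec[of n c x ?y] unfolding invariant_point_def by simp
      qed
      show "L x = 0" if x: "x \<in> qvec n" "tact n th z (- int k) x = x" for x
      proof -
        let ?X = "homog n x (- int k)"
        have "?X \<in> twisted_nonpos n th z" by (rule homog_twisted_nonpos[OF x]) simp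
        then have "pbr n c (linp ?X) h \<in> idealgen (twisted_neg n th z) (salg (twisted n th z))"
          using h f g by (auto simp: Zcent_def)
        then have "0 = ev \<phi> (pbr n c (linp ?X) h)"
          using ev_idealgen_invariant_point[OF \<phi>] by simp
        also have "\<dots> = (\<Sum>a\<in>{- int k}. \<Sum>b\<in>?S. pairing n (slice \<phi> (a + b)) (qbr n c (dvec (linp ?X) \<phi> a) (dvec h \<phi> b)))"
          by (rule ev_pbr_slices) (use x out[OF h] mem[OF h] in \<open>auto simp: dvec_linp tcoef_homog qvec_def\<close>)
        also have "\<dots> = (\<Sum>b\<le>N. pairing n (slice \<phi> (int b - int k)) (qbr n c x (dvec h \<phi> (int b))))"
          by (simp add: int_sum dvec_linp tcoef_homog x)
        also have "\<dots> = L x"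
          unfolding L_def
        \<comment> \<open>Terms with \<open>b < k\<close> lie in negative degree, where the point
          vanishes.\<close>
        proof (rule sum.mono_neutral_cong_right)
          show "\<forall>i\<in>{..N} - {k..N}. pairing n (slice \<phi> (int i - int k)) (qbr n c x (dvec h \<phi> (int i))) = 0"
            using \<phi> by (auto simp: pairing_def slice_def invariant_point_def)
        qed (auto simp: of_nat_diff)
        finally show ?thesis by simp
      qed
    qed (rule x)
    then show ?thesis by (simp add: L_def)
  qed
  have "ev \<phi> (pbr n c f g)
      = (\<Sum>a\<in>?S. \<Sum>b\<in>?S. pairing n (slice \<phi> (a + b)) (qbr n c (dvec f \<phi> a) (dvec g \<phi> b)))"
    by (rule ev_pbr_slices) (use out mem in auto)
  also have "\<dots> = (\<Sum>a\<le>N. \<Sum>b\<le>N. pairing n (slice \<phi> (int (a + b))) (qbr n c (dvec f \<phi> (int a)) (dvec g \<phi> (int b))))"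
    by (simp add: int_sum)
  also have "\<dots> = 0"
    using invariant_brackets_vanish[OF lie, of J "\<lambda>a. slice \<phi> (int a)" N "\<lambda>a. dvec f \<phi> (int a)" "\<lambda>a. dvec g \<phi> (int a)"]
      J0 J inv[of f] inv[of g] by simp
  finally show ?thesis .
qed

section \<open>Reduction to invariant points and to a line through the regular form\<close>

lemma ev_linp_slices:
  assumes "x \<in> loopvec n"
  shows "ev \<phi> (linp x) = (\<Sum>a\<in>snd ` Poly_Mapping.keys x. pairing n (slice \<phi> a) (tcoef x a))"
proof -
  let ?A = "snd ` Poly_Mapping.keys x"
  have "Poly_Mapping.keys x \<subseteq> {..<n} \<times> ?A"
  proof
    fix v assume v: "v \<in> Poly_Mapping.keys x"
    obtain i a where ia: "v = (i, a)" by (cases v)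
    have "i < n" using assms v unfolding loopvec_def ia by blast
    moreover have "a \<in> ?A" using v ia by force
    ultimately show "v \<in> {..<n} \<times> ?A" by (simp add: ia)
  qed
  then have "ev \<phi> (linp x) = (\<Sum>v\<in>{..<n} \<times> ?A. lkp x v * \<phi> v)"
    unfolding ev_linp by (intro sum.mono_neutral_left) (auto simp: in_keys_iff)
  also have "\<dots> = (\<Sum>i<n. \<Sum>a\<in>?A. lkp x (i, a) * \<phi> (i, a))"
    by (simp add: sum.cartesian_product case_prod_beta)
  also have "\<dots> = (\<Sum>a\<in>?A. \<Sum>i<n. lkp x (i, a) * \<phi> (i, a))" by (rule sum.swap)
  finally show ?thesis by (simp add: pairing_def slice_def tcoef_def mult.commute)
qed

definition average_point :: "nat \<Rightarrow> (nat \<Rightarrow> nat \<Rightarrow> 'k::field) \<Rightarrow> 'k \<Rightarrow> nat \<Rightarrow> (nat \<times> int \<Rightarrow> 'k) \<Rightarrow> (nat \<times> int \<Rightarrow> 'k)" where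
  "average_point n th z m \<phi> = (\<lambda>(l, a). if a < 0 then 0 else average n th z m a (slice \<phi> a) l)"

lemma slice_average_point:
  "slice (average_point n th z m \<phi>) a = (if a < 0 then 0 else average n th z m a (slice \<phi> a))"
  by (auto simp: slice_def average_point_def fun_eq_iff)

lemma pairing_zero_left: "pairing n 0 x = 0"
  by (simp add: pairing_def)

lemma invariant_average_point:
  assumes "is_aut_order n c th m" "primitive_root m z"
  shows "invariant_point n th z (average_point n th z m \<phi>)"
  using average_invariant[OF assms]
  by (auto simp: invariant_point_def slice_average_point pairing_zero_left)
    (simp add: average_point_def)

text \<open>Averaging does not change the differentials, because the derivatives lie in
  \<open>salg (twisted_plus n th z)\<close>. The brackets of their components are fixed vectors, and
  in nonnegative degree the averaged slice pairs with those as before.\<close>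

lemma ev_pbr_average_point:
  fixes z :: "'k::field_char_0"
  assumes aut: "is_aut_order n c th m" "primitive_root m z"
    and f: "f \<in> salg (twisted_plus n th z)" and g: "g \<in> salg (twisted_plus n th z)"
  shows "ev (average_point n th z m \<phi>) (pbr n c f g) = ev \<phi> (pbr n c f g)"
proof -
  let ?\<psi> = "average_point n th z m \<phi>"
  have m: "0 < m" using aut(1) by (simp add: is_aut_order_def)
  have z0: "z \<noteq> 0" by (rule primitive_root_nonzero[OF aut(2) m])
  have lin: "ev ?\<psi> (linp x) = ev \<phi> (linp x)" if x: "x \<in> twisted_plus n th z" for x
  proof -
    have xl: "x \<in> loopvec n" using x by (simp add: twisted_plus_def twisted_def)
    have "pairing n (slice ?\<psi> a) (tcoef x a) = pairing n (slice \<phi> a) (tcoef x a)"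
      if "a \<in> snd ` Poly_Mapping.keys x" for a
    proof -
      have "\<not> a < 0" using that twisted_plus_lookup[OF x] by (auto simp: in_keys_iff)
      moreover have "tact n th z a (tcoef x a) = tcoef x a"
        using x by (simp add: tact_def twisted_plus_def twisted_def)
      ultimately show ?thesis by (simp add: slice_average_point average_on_fixed[OF m])
    qed
    then show ?thesis by (simp add: ev_linp_slices[OF xl])
  qed
  have dv: "dvec h ?\<psi> a = dvec h \<phi> a" if "h \<in> salg (twisted_plus n th z)" for h a
    using ev_cong_salg[OF lin pdiff_salg[OF that]] by (simp add: dvec_def fun_eq_iff)
  let ?S = "snd ` pvars f" and ?T = "snd ` pvars g"
  have slices: "ev \<chi> (pbr n c f g)
      = (\<Sum>a\<in>?S. \<Sum>b\<in>?T. pairing n (slice \<chi> (a + b)) (qbr n c (dvec f \<chi> a) (dvec g \<chi> b)))" for \<chi>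
    by (rule ev_pbr_slices)
      (simp_all add: dvec_salg_twisted_plus(2)[OF f] dvec_salg_twisted_plus(2)[OF g] dvec_outside_pvars)
  have "pairing n (slice ?\<psi> (a + b)) (qbr n c (dvec f \<phi> a) (dvec g \<phi> b))
      = pairing n (slice \<phi> (a + b)) (qbr n c (dvec f \<phi> a) (dvec g \<phi> b))" for a b
  proof (cases "a < 0 \<or> b < 0")
    case True
    then have "qbr n c (dvec f \<phi> a) (dvec g \<phi> b) = 0"
      using dvec_salg_twisted_plus(3)[OF f, of a \<phi>] dvec_salg_twisted_plus(3)[OF g, of b \<phi>]
      by (auto simp: qbr_def fun_eq_iff)
    then show ?thesis by (simp only: pairing_0)
  next
    case False
    have "tact n th z (a + b) (qbr n c (dvec f \<phi> a) (dvec g \<phi> b)) = qbr n c (dvec f \<phi> a) (dvec g \<phi> b)"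
      using tact_qbr[OF aut(1) z0 dvec_salg_twisted_plus(2)[OF f] dvec_salg_twisted_plus(2)[OF g]]
      by (simp add: dvec_salg_twisted_plus(1)[OF f] dvec_salg_twisted_plus(1)[OF g])
    then show ?thesis using False by (simp add: slice_average_point average_on_fixed[OF m])
  qed
  then show ?thesis unfolding slices by (simp add: dv[OF f] dv[OF g])
qed

lemma pairing_line:
  "pairing n (slice (\<lambda>v. \<phi> v + s * (\<psi> v - \<phi> v)) a) x
    = pairing n (slice \<phi> a) x + s * (pairing n (slice \<psi> a) x - pairing n (slice \<phi> a) x)"
  by (simp add: pairing_def slice_def sum_distrib_left sum_subtractf sum.distrib algebra_simps)

lemma invariant_point_line:
  assumes "invariant_point n th z \<phi>" "invariant_point n th z \<psi>"
  shows "invariant_point n th z (\<lambda>v. \<phi> v + s * (\<psi> v - \<phi> v))"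
  using assms by (simp add: invariant_point_def pairing_line)

text \<open>If the bracket is nonzero somewhere, it is nonzero at an invariant point. On the line
  from there to the point given by \<open>rho\<close>, it vanishes wherever a certain nonzero
  determinant does not, hence identically.\<close>

lemma pbr_Zcent_Zcent:
  fixes c :: "nat \<Rightarrow> nat \<Rightarrow> nat \<Rightarrow> 'k::field_char_0"
  assumes lie: "is_lie_algebra n c" and aut: "is_aut_order n c th m" "primitive_root m z"
    and rho: "rho \<in> regular n c" "rho \<in> dual0 n th z m"
    and f: "f \<in> Zcent n c th z" and g: "g \<in> Zcent n c th z"
  shows "pbr n c f g = 0"
proof (rule ccontr)
  assume "pbr n c f g \<noteq> 0"
  then obtain \<eta> where \<eta>: "ev \<eta> (pbr n c f g) \<noteq> 0" using spoly_nonzero_point by blast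
  define \<phi> where "\<phi> = average_point n th z m \<eta>"
  define \<psi> where "\<psi> = (\<lambda>(l, a). if a = (0::int) then rho l else 0)"
  have \<phi>nz: "ev \<phi> (pbr n c f g) \<noteq> 0"
    using \<eta> f g by (simp add: \<phi>_def ev_pbr_average_point[OF aut] Zcent_def)
  have inv\<phi>: "invariant_point n th z \<phi>"
    unfolding \<phi>_def by (rule invariant_average_point[OF aut])
  have slice\<psi>: "slice \<psi> a = (if a = 0 then rho else 0)" for a
    by (auto simp: slice_def \<psi>_def fun_eq_iff)
  \<comment> \<open>Only degree 0 matters here, and there invariance holds because
    \<open>rho\<close> kills the eigenspaces with nonzero index.\<close>
  have inv\<psi>: "invariant_point n th z \<psi>"
    using dual0_invariant[OF aut rho(2)]
    by (auto simp: invariant_point_def slice\<psi> pairing_zero_left) (simp add: \<psi>_def)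
  obtain J where J0: "inj_mat n (add_diag J (coadj_mat n c rho))"
    and J: "\<And>eta x. inj_mat n (add_diag J (coadj_mat n c eta)) \<Longrightarrow>
      \<exists>v. (\<forall>i<n. mvec n (coadj_mat n c eta) v i = 0) \<and> (\<forall>j<n. j \<in> J \<longrightarrow> v j = x j)"
    using regular_pivots[OF lie rho(1)] by metis
  define line where "line s = (\<lambda>v. \<phi> v + s * (\<psi> v - \<phi> v))" for s
  \<comment> \<open>The matrix \<open>A + 1_J\<close> of the degree 0 slice, with entries at most
    linear in the line parameter; the value 1 of the parameter gives \<open>rho\<close>.\<close>
  define M where "M = add_diag J (\<lambda>i j. \<Sum>l<n. [:c i j l:] * [:\<phi> (l, 0), \<psi> (l, 0) - \<phi> (l, 0):])"
  have M: "poly_mat M s = add_diag J (coadj_mat n c (slice (line s) 0))" for s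
    unfolding M_def poly_mat_add_diag
    by (intro arg_cong[where f = "add_diag J"] ext)
      (simp add: poly_mat_def coadj_mat_def slice_def line_def poly_sum algebra_simps)
  have "slice (line 1) 0 = rho" by (auto simp: slice_def line_def \<psi>_def fun_eq_iff)
  then have "inj_mat n (poly_mat M 1)" using J0 by (simp add: M)
  then obtain d where d: "poly d 1 \<noteq> 0" "\<And>s. poly d s \<noteq> 0 \<Longrightarrow> inj_mat n (poly_mat M s)"
    using adjugate_exists by blast
  define q where "q = pev (\<lambda>v. [:\<phi> v, \<psi> v - \<phi> v:]) (pbr n c f g)"
  have q: "poly q s = ev (line s) (pbr n c f g)" for s
    by (simp add: q_def poly_pev line_def)
  \<comment> \<open>The determinant may vanish at \<open>s = 0\<close>, the point of interest, so
    the bracket is first shown to vanish as a polynomial in \<open>s\<close>.\<close>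
  have "q = 0"
  proof (rule poly_eqI_cofinite)
    show "d \<noteq> 0" using d(1) by auto
    show "poly q s = poly 0 s" if "poly d s \<noteq> 0" for s
      using pbr_Zcent_vanishes[OF lie aut J _ _ f g, of "line s"]
        invariant_point_line[OF inv\<phi> inv\<psi>, of s] d(2)[OF that]
      by (simp add: q M line_def)
  qed
  then have "ev (line 0) (pbr n c f g) = 0" using q[of 0] by simp
  then show False using \<phi>nz by (simp add: line_def)
qed

section \<open>The invariants form a subalgebra\<close>

lemma twisted_plus_subset: "twisted_plus n th z \<subseteq> twisted n th z"
  by (auto simp: twisted_plus_def)

lemma const_Zcent: "const a \<in> Zcent n c th z"
  by (auto simp: Zcent_def pbr_const_right intro: salg.const idealgen.zero)

lemma add_Zcent: "f \<in> Zcent n c th z \<Longrightarrow> g \<in> Zcent n c th z \<Longrightarrow> f + g \<in> Zcent n c th z"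
  by (auto simp: Zcent_def pbr_add_right intro: salg.add idealgen.add)

text \<open>The Leibniz rule multiplies elements of the ideal by \<open>f\<close> and
  \<open>g\<close>. These lie in \<open>salg (twisted n th z)\<close>, under which the ideal is
  closed.\<close>

lemma mult_Zcent:
  assumes f: "f \<in> Zcent n c th z" and g: "g \<in> Zcent n c th z"
  shows "f * g \<in> Zcent n c th z"
proof -
  have "f \<in> salg (twisted n th z)" "g \<in> salg (twisted n th z)"
    using f g salg_mono[OF twisted_plus_subset] by (auto simp: Zcent_def)
  with f g show ?thesis
    by (auto simp: Zcent_def pbr_mult_right intro: salg.mult intro!: idealgen.add idealgen_mult_right)
qed

theorem theorem2p2:
  fixes n m :: nat
    and c :: "nat \<Rightarrow> nat \<Rightarrow> nat \<Rightarrow> 'k::field_char_0"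
    and th :: "nat \<Rightarrow> nat \<Rightarrow> 'k"
    and z :: 'k
  assumes "alg_closed TYPE('k)"
    and "is_lie_algebra n c"
    and "is_aut_order n c th m"
    and "primitive_root m z"
    and "regular n c \<inter> dual0 n th z m \<noteq> {}"
  shows "Zcent n c th z \<subseteq> salg (twisted_plus n th z)
     \<and> (\<forall>a. const a \<in> Zcent n c th z)
     \<and> (\<forall>f\<in>Zcent n c th z. \<forall>g\<in>Zcent n c th z. f + g \<in> Zcent n c th z \<and> f * g \<in> Zcent n c th z)
     \<and> (\<forall>f\<in>Zcent n c th z. \<forall>g\<in>Zcent n c th z. pbr n c f g = 0)"
proof -
  obtain rho where "rho \<in> regular n c" "rho \<in> dual0 n th z m" using assms(5) by blast
  then have "pbr n c f g = 0" if "f \<in> Zcent n c th z" "g \<in> Zcent n c th z" for f g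
    using pbr_Zcent_Zcent[OF assms(2-4)] that by blast
  moreover have "Zcent n c th z \<subseteq> salg (twisted_plus n th z)" by (auto simp: Zcent_def)
  ultimately show ?thesis by (simp add: const_Zcent add_Zcent mult_Zcent)
qed

end
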